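(* Fix $T>0$ and let $$\Omega=\{q=(x,y)\in H^1([0,T],\mathbb R^2): y(0)=0,\ y(T)=0,\ x(0)\ge 0,\ x(T)\le 0\},$$ $$\mathcal A(q)=\int_0^T\Big(\frac12|\dot q(t)|^2+\frac{1}{|q(t)|}+x(t)\Big)\,dt .$$ Then every global minimizer of $\mathcal A$ on $\Omega$ is half of a collision–ejection orbit of the planar Stark problem $\ddot x=-x/r^3+1$, $\ddot y=-y/r^3$ ($r=\sqrt{x^2+y^2}$) lying on the negative $x$-axis, i.e. the corresponding collision–ejection orbit has period $2T$.
   Context: A collision–ejection orbit on the negative $x$-axis is a solution moving on $\{(x,0):x<0\}$ which collides with the origin and (after regularization) is ejected back along the same half-line; it is periodic. *)

theory Defs
  imports "HOL-Analysis.Analysis"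
begin

text \<open>Paths in the plane are functions real => real * real; the norm on real * real is
  the Euclidean norm. Only the values on [0,T] matter for the variational problem.\<close>

text \<open>v is a (Lebesgue) weak derivative of q on [0,T] with v in L^2: q is the
  absolutely continuous representative of an H^1 function with derivative v.\<close>
definition H1_deriv :: "real \<Rightarrow> (real \<Rightarrow> real \<times> real) \<Rightarrow> (real \<Rightarrow> real \<times> real) \<Rightarrow> bool" where
  "H1_deriv T q v \<longleftrightarrow>
     set_integrable lborel {0..T} v \<and>
     set_integrable lborel {0..T} (\<lambda>t. (norm (v t))\<^sup>2) \<and>
     (\<forall>t\<in>{0..T}. q t = q 0 + (LINT s:{0..t}|lborel. v s))"

definition H1 :: "real \<Rightarrow> (real \<Rightarrow> real \<times> real) \<Rightarrow> bool" where
  "H1 T q \<longleftrightarrow> (\<exists>v. H1_deriv T q v)"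

definition Omega :: "real \<Rightarrow> (real \<Rightarrow> real \<times> real) set" where
  "Omega T = {q. H1 T q \<and> snd (q 0) = 0 \<and> snd (q T) = 0 \<and> fst (q 0) \<ge> 0 \<and> fst (q T) \<le> 0}"

text \<open>Action with a given weak derivative; the Newtonian term 1/|q| is +infinity at collisions,
  so the action takes values in (-infinity, +infinity].\<close>
definition action_with :: "real \<Rightarrow> (real \<Rightarrow> real \<times> real) \<Rightarrow> (real \<Rightarrow> real \<times> real) \<Rightarrow> ereal" where
  "action_with T q v =
     enn2ereal (\<integral>\<^sup>+ t\<in>{0..T}. (ennreal ((norm (v t))\<^sup>2 / 2)
         + (if q t = 0 then \<infinity> else ennreal (1 / norm (q t)))) \<partial>lborel)
     + ereal (LINT t:{0..T}|lborel. fst (q t))"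

definition action :: "real \<Rightarrow> (real \<Rightarrow> real \<times> real) \<Rightarrow> ereal" where
  "action T q = action_with T q (SOME v. H1_deriv T q v)"

definition global_minimizer :: "real \<Rightarrow> (real \<Rightarrow> real \<times> real) \<Rightarrow> bool" where
  "global_minimizer T q \<longleftrightarrow> q \<in> Omega T \<and> (\<forall>q'\<in>Omega T. action T q \<le> action T q')"

definition stark_field :: "real \<times> real \<Rightarrow> real \<times> real" where
  "stark_field p = (- fst p / norm p ^ 3 + 1, - snd p / norm p ^ 3)"

end

theory Submission
  imports Defs
begin

text \<open>
  In parabolic coordinates \<open>\<xi>\<^sup>2 = (r + x)/2\<close>, \<open>\<eta>\<^sup>2 = (r - x)/2\<close> and Levi-Civita time \<open>ds = dt/r\<close>
  the action separates into the integral of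
  \<open>2 (\<xi>'\<^sup>2 + \<eta>'\<^sup>2) + 1 + \<xi>\<^sup>4 - \<eta>\<^sup>4\<close> over \<open>[0, S]\<close>, with the constraint that \<open>\<xi>\<^sup>2 + \<eta>\<^sup>2\<close> has
  integral \<open>T\<close> and the boundary conditions \<open>\<eta>(0) = 0 = \<xi>(S)\<close>.
  Reversing \<open>\<xi>\<close> in time and putting \<open>H(s)\<^sup>2 = \<eta>(s)\<^sup>2 + \<xi>(S - s)\<^sup>2\<close> yields the profile of a path on
  the negative axis which satisfies the same constraints, has no larger kinetic term, and gains
  at least twice the integral of \<open>\<xi>\<^sup>4\<close>. Hence \<open>\<xi> = 0\<close> for a minimizer.
  To avoid a chain rule for \<open>H\<^sup>1\<close> paths through collisions, the kinetic term in Levi-Civita time is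
  replaced by its difference quotients on uniform grids, and the path with profile \<open>H\<close> by
  interpolants whose profile is piecewise linear.

  On the axis the distance \<open>r\<close> to the origin is positive after time 0, and the first variation, with
  the end at time \<open>T\<close> left free, gives \<open>r'(t) = \<integral>\<^sub>t\<^sup>T (1/r\<^sup>2 + 1)\<close>. In particular \<open>r'(T) = 0\<close>, so the
  even \<open>2T\<close>-periodic extension is a solution away from collisions.
\<close>

section \<open>Integration and differentiation on intervals\<close>

lemma AE_zero_if_integral_atMost_zero:
  fixes f :: "real \<Rightarrow> 'a::{banach, second_countable_topology}"
  assumes f: "integrable lborel f"
    and zero: "\<And>a. (LINT x:{..a}|lborel. f x) = 0"
  shows "AE x in lborel. f x = 0"
proof (rule sigma_finite_measure.density_zero[OF lborel.sigma_finite_measure_axioms f])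
  have set_int: "set_integrable lborel A f" if "A \<in> sets lborel" for A
    unfolding set_integrable_def using f that by (intro integrable_mult_indicator) auto
  have "(\<lambda>n. LINT x:{..real n}|lborel. f x) \<longlonglongrightarrow> (LINT x:(\<Union>n. {..real n})|lborel. f x)"
    by (intro set_integral_cont_up set_int) (auto simp: incseq_def)
  moreover have "(\<Union>n. {..real n}) = UNIV"
    by (auto simp: real_arch_simple)
  ultimately have total: "(LINT x:UNIV|lborel. f x) = 0"
    by (simp add: zero LIMSEQ_const_iff)
  fix A :: "real set" assume "A \<in> sets lborel"
  then have A: "A \<in> sigma_sets UNIV (range atMost)"
    by (simp add: borel_eq_atMost)
  have "Int_stable (range (atMost :: real \<Rightarrow> real set))"
    unfolding Int_stable_def by (auto simp: image_iff)
  moreover have "range atMost \<subseteq> Pow (UNIV :: real set)"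
    by simp
  ultimately show "(LINT x:A|lborel. f x) = 0"
    using A
  proof (induction rule: sigma_sets_induct_disjoint)
    case (basic A)
    then show ?case using zero by auto
  next
    case (compl A)
    then have "A \<in> sets borel" by (simp add: borel_eq_atMost)
    then have "(LINT x:A \<union> (UNIV - A)|lborel. f x)
        = (LINT x:A|lborel. f x) + (LINT x:UNIV - A|lborel. f x)"
      by (intro set_integral_Un set_int) auto
    then show ?case using compl total by simp
  next
    case (union A)
    then have "range A \<subseteq> sets borel" by (simp add: borel_eq_atMost)
    then have "(LINT x:(\<Union>i. A i)|lborel. f x) = (\<Sum>i. LINT x:A i|lborel. f x)"
      using union(1) by (intro lebesgue_integral_countable_add set_int) (auto simp: disjoint_family_on_def)
    then show ?case using union by simp
  qed (auto simp: set_lebesgue_integral_def)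
qed

lemma has_integral_If_le:
  fixes f g :: "real \<Rightarrow> 'a::banach"
  assumes f: "(f has_integral x) {a..b}" and g: "(g has_integral y) {b..c}" and "a \<le> b" "b \<le> c"
  shows "((\<lambda>t. if t \<le> b then f t else g t) has_integral x + y) {a..c}"
proof (rule has_integral_combine[OF assms(3,4)])
  show "((\<lambda>t. if t \<le> b then f t else g t) has_integral x) {a..b}"
    by (rule has_integral_eq[OF _ f]) simp
  show "((\<lambda>t. if t \<le> b then f t else g t) has_integral y) {b..c}"
    by (rule has_integral_spike_finite[OF _ _ g, of "{b}"]) auto
qed

lemma integral_If_le:
  fixes f g :: "real \<Rightarrow> 'a::banach"
  assumes "f integrable_on {a..b}" "g integrable_on {b..c}" "a \<le> b" "b \<le> c"
  shows "integral {a..c} (\<lambda>t. if t \<le> b then f t else g t) = integral {a..b} f + integral {b..c} g"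
  using assms by (intro integral_unique has_integral_If_le integrable_integral)

lemma set_integrable_If_le:
  fixes f g :: "real \<Rightarrow> 'a::{banach, second_countable_topology}"
  assumes f: "set_integrable lborel {a..b} f" and g: "set_integrable lborel {b..c} g"
    and "a \<le> b" "b \<le> c"
  shows "set_integrable lborel {a..c} (\<lambda>t. if t \<le> b then f t else g t)"
proof -
  let ?h = "\<lambda>t. if t \<le> b then f t else g t"
  have "set_integrable lborel {a..b} ?h"
    using f by (subst set_integrable_cong[OF refl refl]) auto
  moreover have "set_integrable lborel {b<..c} g"
    using g by (rule set_integrable_subset) auto
  then have "set_integrable lborel {b<..c} ?h"
    by (subst set_integrable_cong[OF refl refl]) auto
  ultimately have "set_integrable lborel ({a..b} \<union> {b<..c}) ?h"
    by (intro set_integrable_Un) auto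
  moreover have "{a..b} \<union> {b<..c} = {a..c}"
    using assms(3,4) by auto
  ultimately show ?thesis by simp
qed

lemma set_integrable_if_nonneg_integrable_on:
  fixes f :: "real \<Rightarrow> real"
  assumes meas: "set_borel_measurable borel A f" and [measurable]: "A \<in> sets borel"
    and nonneg: "\<And>t. t \<in> A \<Longrightarrow> 0 \<le> f t" and f: "f integrable_on A"
  shows "set_integrable lborel A f"
proof -
  have "f absolutely_integrable_on A"
    using f nonneg by (rule nonnegative_absolutely_integrable_1)
  then show ?thesis
    using meas unfolding set_integrable_def set_borel_measurable_def
    by (subst (asm) integrable_completion) auto
qed

lemma set_integrable_norm_power2_bound:
  fixes f :: "real \<Rightarrow> 'a::{banach, second_countable_topology}" and g :: "real \<Rightarrow> real"
  assumes f: "set_integrable lborel A f" and g: "set_integrable lborel A g"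
    and fg: "\<And>t. (norm (f t))\<^sup>2 \<le> g t"
  shows "set_integrable lborel A (\<lambda>t. (norm (f t))\<^sup>2)"
  using g
proof (rule set_integrable_bound)
  have [measurable]: "(\<lambda>t. indicator A t *\<^sub>R f t) \<in> borel_measurable borel"
    using borel_measurable_integrable[OF f[unfolded set_integrable_def]] by simp
  have "(\<lambda>t. indicator A t *\<^sub>R (norm (f t))\<^sup>2) = (\<lambda>t. (norm (indicator A t *\<^sub>R f t))\<^sup>2)"
    by (auto simp: indicator_def)
  also have "\<dots> \<in> borel_measurable borel" by measurable
  finally show "set_borel_measurable lborel A (\<lambda>t. (norm (f t))\<^sup>2)"
    by (simp add: set_borel_measurable_def)
  have "norm ((norm (f t))\<^sup>2) \<le> norm (g t)" for t
    using fg[of t] by simp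
  then show "AE t in lborel. t \<in> A \<longrightarrow> norm ((norm (f t))\<^sup>2) \<le> norm (g t)"
    by simp
qed

lemma integral_power2:
  assumes "a \<le> (b::real)"
  shows "integral {a..b} (\<lambda>s. s\<^sup>2) = (b ^ 3 - a ^ 3) / 3"
proof -
  have "((\<lambda>s. s\<^sup>2) has_integral b ^ 3 / 3 - a ^ 3 / 3) {a..b}"
    using assms by (intro fundamental_theorem_of_calculus)
      (auto intro!: derivative_eq_intros simp: has_real_derivative_iff_has_vector_derivative[symmetric])
  then show ?thesis
    by (simp add: integral_unique diff_divide_distrib)
qed

lemma integral_reflect_interval:
  fixes f :: "real \<Rightarrow> 'a::euclidean_space"
  assumes "0 \<le> S" "continuous_on {0..S} f"
  shows "integral {0..S} (\<lambda>s. f (S - s)) = integral {0..S} f"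
proof -
  have "((\<lambda>s. (- 1) *\<^sub>R f (S - s)) has_integral integral {S - 0..S - S} f - integral {S - S..S - 0} f) {0..S}"
    using assms by (intro has_integral_substitution_general[of "{}" _ _ _ 0 S])
      (auto intro!: continuous_intros derivative_eq_intros)
  then have "((\<lambda>s. - f (S - s)) has_integral - integral {0..S} f) {0..S}"
    using assms(1) by (cases "S = 0") simp_all
  then show ?thesis
    by (simp add: has_integral_neg_iff integral_unique)
qed

lemma sum_integral_adjacent:
  fixes x :: "nat \<Rightarrow> real" and f :: "real \<Rightarrow> 'a::banach"
  assumes "\<And>i. i < n \<Longrightarrow> x i \<le> x (Suc i)" and "f integrable_on {x 0..x n}"
  shows "(\<Sum>i<n. integral {x i..x (Suc i)} f) = integral {x 0..x n} f"
  using assms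
proof (induction n)
  case (Suc n)
  have "x 0 \<le> x k" if "k \<le> n" for k
    using that Suc.prems(1) by (induction k) (auto intro: order_trans)
  then have x: "x 0 \<le> x n" "x n \<le> x (Suc n)"
    using Suc.prems(1) by auto
  have "f integrable_on {x 0..x n}"
    using Suc.prems(2) by (rule integrable_on_subinterval) (use x in auto)
  then show ?case
    using Suc x Henstock_Kurzweil_Integration.integral_combine[OF x Suc.prems(2)] by simp
qed simp

lemma integrable_on_continuous_mult:
  fixes f g :: "real \<Rightarrow> real"
  assumes f: "continuous_on {a..b} f" and g: "g integrable_on {a..b}" "\<And>t. t \<in> {a..b} \<Longrightarrow> 0 \<le> g t"
  shows "(\<lambda>t. f t * g t) integrable_on {a..b}"
proof -
  have "(\<lambda>t. f t * g t) absolutely_integrable_on {a..b}"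
  proof (rule absolutely_integrable_bounded_measurable_product_real)
    show "f \<in> borel_measurable (lebesgue_on {a..b})"
      by (intro continuous_imp_measurable_on_sets_lebesgue f) auto
    show "bounded (f ` {a..b})"
      by (intro compact_imp_bounded compact_continuous_image f) auto
    show "g absolutely_integrable_on {a..b}"
      using g by (rule nonnegative_absolutely_integrable_1)
  qed auto
  then show ?thesis
    by (rule set_lebesgue_integral_eq_integral)
qed

lemma Cauchy_Schwarz_integral:
  fixes f g :: "real \<Rightarrow> real"
  assumes f: "(\<lambda>t. (f t)\<^sup>2) integrable_on A" and g: "(\<lambda>t. (g t)\<^sup>2) integrable_on A"
    and fg: "(\<lambda>t. f t * g t) integrable_on A"
  shows "(integral A (\<lambda>t. f t * g t))\<^sup>2 \<le> integral A (\<lambda>t. (f t)\<^sup>2) * integral A (\<lambda>t. (g t)\<^sup>2)"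
proof -
  define F G B where "F = integral A (\<lambda>t. (f t)\<^sup>2)" and "G = integral A (\<lambda>t. (g t)\<^sup>2)"
    and "B = integral A (\<lambda>t. f t * g t)"
  have F: "F \<ge> 0"
    unfolding F_def by (intro integral_nonneg f) simp
  have quadratic: "0 \<le> F * x\<^sup>2 + 2 * B * x + G" for x
  proof -
    have "((\<lambda>t. (f t)\<^sup>2 * x\<^sup>2 + (f t * g t) * (2 * x) + (g t)\<^sup>2) has_integral F * x\<^sup>2 + B * (2 * x) + G) A"
      unfolding F_def G_def B_def
      by (intro has_integral_add has_integral_mult_left integrable_integral f g fg)
    then have "((\<lambda>t. (x * f t + g t)\<^sup>2) has_integral F * x\<^sup>2 + 2 * B * x + G) A"
      by (simp add: power2_eq_square algebra_simps)
    then show ?thesis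
      by (rule has_integral_nonneg) simp
  qed
  have "B\<^sup>2 \<le> F * G"
  proof (cases "F = 0")
    case True
    have "B = 0"
    proof (rule ccontr)
      assume "B \<noteq> 0"
      then show False
        using quadratic[of "- (G + 1) / (2 * B)"] True by (simp add: field_simps)
    qed
    then show ?thesis using True by simp
  next
    case False
    then show ?thesis
      using quadratic[of "- B / F"] F by (simp add: field_simps power2_eq_square)
  qed
  then show ?thesis by (simp add: F_def G_def B_def)
qed

lemma norm_diff_le_integral_if_locally:
  fixes f :: "real \<Rightarrow> 'a::real_normed_vector" and F :: "real \<Rightarrow> real"
  assumes ab: "a \<le> b" and F: "F integrable_on {a..b}"
    and locally: "\<And>x k. \<lbrakk>x \<in> {a..b}; 0 < k; k < 1\<rbrakk> \<Longrightarrow> \<exists>d>0. \<forall>s t.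
      a \<le> s \<and> s \<le> x \<and> x \<le> t \<and> t \<le> b \<and> t - s < d \<longrightarrow> k * norm (f t - f s) \<le> integral {s..t} F"
  shows "norm (f b - f a) \<le> integral {a..b} F"
proof (rule field_le_mult_one_interval)
  fix k :: real assume k: "0 < k" "k < 1"
  define P where "P s t \<longleftrightarrow> a \<le> s \<and> t \<le> b \<longrightarrow> k * norm (f t - f s) \<le> integral {s..t} F" for s t
  from ab have "P a b"
  proof (induction rule: Bolzano)
    case (trans s t u)
    show ?case
      unfolding P_def
    proof
      assume su: "a \<le> s \<and> u \<le> b"
      have "norm (f u - f s) \<le> norm (f t - f s) + norm (f u - f t)"
        using norm_triangle_ineq[of "f t - f s" "f u - f t"] by simp
      then have "k * norm (f u - f s) \<le> k * norm (f t - f s) + k * norm (f u - f t)"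
        unfolding distrib_left[symmetric] using k(1) by (intro mult_left_mono) auto
      also have "\<dots> \<le> integral {s..t} F + integral {t..u} F"
        using trans su by (intro add_mono) (auto simp: P_def)
      also have "\<dots> = integral {s..u} F"
        using trans su
        by (intro Henstock_Kurzweil_Integration.integral_combine integrable_on_subinterval[OF F]) auto
      finally show "k * norm (f u - f s) \<le> integral {s..u} F" .
    qed
  next
    case (local x)
    then obtain d where "d > 0" "\<forall>s t. a \<le> s \<and> s \<le> x \<and> x \<le> t \<and> t \<le> b \<and> t - s < d \<longrightarrow>
        k * norm (f t - f s) \<le> integral {s..t} F"
      using locally[of x k] k by auto
    then show ?case unfolding P_def by blast
  qed
  then show "k * norm (f b - f a) \<le> integral {a..b} F"
    by (simp add: P_def)
qed

lemma has_real_derivative_if_integral: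
  fixes f h :: "real \<Rightarrow> real"
  assumes h: "\<And>d. a < d \<Longrightarrow> continuous_on {d..b} h"
    and f: "\<And>d y. \<lbrakk>a < d; d \<le> y; y \<le> b\<rbrakk> \<Longrightarrow> f y - f d = integral {d..y} h"
    and x: "x \<in> {a<..b}"
  shows "(f has_real_derivative h x) (at x within {a<..b})"
proof -
  define d where "d = (a + x) / 2"
  have d: "a < d" "d < x" "x \<le> b" using x by (auto simp: d_def)
  have "((\<lambda>y. integral {d..y} h) has_real_derivative h x) (at x within {d..b})"
    using d by (intro integral_has_real_derivative h) auto
  then have "((\<lambda>y. f d + integral {d..y} h) has_real_derivative 0 + h x) (at x within {d..b})"
    by (intro DERIV_add DERIV_const)
  then have "(f has_real_derivative 0 + h x) (at x within {d..b})"
  proof (rule has_field_derivative_transform_within[OF _ zero_less_one])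
    show "f d + integral {d..y} h = f y" if "y \<in> {d..b}" for y
      using f[OF d(1), of y] that by simp
  qed (use d in simp)
  moreover have "at x within {d..b} = at x within {a<..b}"
    by (rule at_within_nhd[of _ "{d<..}"]) (use d in auto)
  ultimately show ?thesis by simp
qed

lemma has_real_derivative_reflect:
  fixes f :: "real \<Rightarrow> real"
  assumes f: "(f has_real_derivative D) (at (c - x) within {a<..b})"
  shows "((\<lambda>x. f (c - x)) has_real_derivative - D) (at x within {c - b..<c - a})"
proof -
  have "((\<lambda>x. c - x) has_real_derivative - 1) (at x within {c - b..<c - a})"
    by (auto intro!: derivative_eq_intros)
  moreover have "(\<lambda>x. c - x) ` {c - b..<c - a} = {a<..b}"
    by (auto simp: image_iff intro!: bexI[of _ "c - y" for y])
  ultimately have "(f \<circ> (\<lambda>x. c - x) has_real_derivative D * - 1) (at x within {c - b..<c - a})"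
    using f by (intro DERIV_image_chain) simp_all
  then show ?thesis by (simp add: o_def)
qed

lemma has_real_derivative_reflect_extension:
  fixes f f' :: "real \<Rightarrow> real" and k :: real
  assumes f: "\<And>x. x \<in> {0<..T} \<Longrightarrow> (f has_real_derivative f' x) (at x within {0<..T})"
    and match: "f T = k * f T" "f' T = - k * f' T" and t: "t \<in> {0<..<2 * T}"
  shows "((\<lambda>t. if t \<le> T then f t else k * f (2 * T - t)) has_real_derivative
    (if t \<le> T then f' t else - k * f' (2 * T - t))) (at t)"
proof -
  have T: "T > 0" using t by auto
  have right: "((\<lambda>x. k * f (2 * T - x)) has_real_derivative - k * f' (2 * T - x)) (at x within {T..<2 * T})"
    if "x \<in> {T..<2 * T}" for x
    using DERIV_cmult[OF has_real_derivative_reflect[of f "f' (2 * T - x)" "2 * T" x 0 T], of k] f that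
    by simp
  have closures: "closure {0<..T} = {0..T}" "closure {T..<2 * T} = {T..2 * T}"
    using T by simp_all
  have unions: "{0<..T} \<union> (closure {0<..T} \<inter> closure {T..<2 * T}) = {0<..T}"
    "{T..<2 * T} \<union> (closure {0<..T} \<inter> closure {T..<2 * T}) = {T..<2 * T}"
    unfolding closures using T by auto
  have "((\<lambda>t. if t \<in> {0<..T} then f t else k * f (2 * T - t)) has_vector_derivative
      (if t \<in> {0<..T} then f' t else - k * f' (2 * T - t))) (at t within {0<..<2 * T})"
  proof (rule has_vector_derivative_If_within_closures[where T = "{T..<2 * T}"])
    show "{0<..<2 * T} = {0<..T} \<union> {T..<2 * T}" using T by auto
    show "(f has_vector_derivative f' t) (at t within {0<..T} \<union> (closure {0<..T} \<inter> closure {T..<2 * T}))"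
      if "t \<in> {0<..T} \<union> (closure {0<..T} \<inter> closure {T..<2 * T})"
      using f that unfolding unions has_real_derivative_iff_has_vector_derivative by blast
    show "((\<lambda>t. k * f (2 * T - t)) has_vector_derivative - k * f' (2 * T - t))
        (at t within {T..<2 * T} \<union> (closure {0<..T} \<inter> closure {T..<2 * T}))"
      if "t \<in> {T..<2 * T} \<union> (closure {0<..T} \<inter> closure {T..<2 * T})"
      using right that unfolding unions has_real_derivative_iff_has_vector_derivative by blast
  qed (use t match closures in auto)
  moreover have "at t within {0<..<2 * T} = at t"
    using t by (intro at_within_open) auto
  ultimately have "((\<lambda>t. if t \<in> {0<..T} then f t else k * f (2 * T - t)) has_real_derivative
      (if t \<le> T then f' t else - k * f' (2 * T - t))) (at t)"
    using t by (simp add: has_real_derivative_iff_has_vector_derivative)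
  then show ?thesis
    by (rule has_field_derivative_transform_within_open[of _ _ _ "{0<..<2 * T}"]) (use t in auto)
qed

lemma has_real_derivative_periodic:
  fixes f :: "real \<Rightarrow> real"
  assumes "\<And>t. f (t + p) = f t" and "(f has_real_derivative D) (at t)"
  shows "(f has_real_derivative D) (at (t + p))"
  using assms by (simp add: DERIV_shift)

section \<open>Square-integrable weak derivatives\<close>

definition L2_deriv ::
    "real \<Rightarrow> real \<Rightarrow> (real \<Rightarrow> 'a::euclidean_space) \<Rightarrow> (real \<Rightarrow> 'a) \<Rightarrow> bool" where
  "L2_deriv a b q v \<longleftrightarrow>
     set_integrable lborel {a..b} v \<and>
     set_integrable lborel {a..b} (\<lambda>t. (norm (v t))\<^sup>2) \<and>
     (\<forall>t\<in>{a..b}. (v has_integral q t - q a) {a..t})"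

lemma L2_derivD:
  assumes "L2_deriv a b q v"
  shows "set_integrable lborel {a..b} v" "set_integrable lborel {a..b} (\<lambda>t. (norm (v t))\<^sup>2)"
    and "t \<in> {a..b} \<Longrightarrow> (v has_integral q t - q a) {a..t}"
  using assms unfolding L2_deriv_def by blast+

lemma L2_derivI_borel:
  fixes q v :: "real \<Rightarrow> real"
  assumes v: "v \<in> borel_measurable borel" "(\<lambda>t. (v t)\<^sup>2) integrable_on {a..b}"
    and q: "\<And>t. t \<in> {a..b} \<Longrightarrow> (v has_integral q t - q a) {a..t}"
  shows "L2_deriv a b q v"
proof -
  have v2: "set_integrable lborel {a..b} (\<lambda>t. (v t)\<^sup>2)"
    using v by (intro set_integrable_if_nonneg_integrable_on) (simp_all add: set_borel_measurable_def)
  have "set_integrable lborel {a..b} v"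
  proof (rule set_integrable_bound)
    show "set_integrable lborel {a..b} (\<lambda>t. 1 + (v t)\<^sup>2)"
      by (intro set_integral_add v2 borel_integrable_atLeastAtMost' continuous_intros)
    show "set_borel_measurable lborel {a..b} v"
      using v(1) by (simp add: set_borel_measurable_def)
    have "\<bar>x\<bar> \<le> 1 + x\<^sup>2" for x :: real
      using sum_squares_bound[of 1 "\<bar>x\<bar>"] by simp
    then show "AE t in lborel. t \<in> {a..b} \<longrightarrow> norm (v t) \<le> norm (1 + (v t)\<^sup>2)"
      by simp
  qed
  then show ?thesis
    using v2 q by (simp add: L2_deriv_def)
qed

lemma L2_deriv_const: "L2_deriv a b (\<lambda>t. c) (\<lambda>t. 0)"
  by (simp add: L2_deriv_def set_integrable_def)

lemma H1_deriv_iff_L2_deriv: "H1_deriv T q v \<longleftrightarrow> L2_deriv 0 T q v"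
proof -
  have "q t = q 0 + (LINT s:{0..t}|lborel. v s) \<longleftrightarrow> (v has_integral q t - q 0) {0..t}"
    if "set_integrable lborel {0..T} v" "t \<in> {0..T}" for t
  proof -
    have "set_integrable lborel {0..t} v"
      using that(1) by (rule set_integrable_subset) (use that(2) in auto)
    then have "(v has_integral (LINT s:{0..t}|lborel. v s)) {0..t}"
      using set_borel_integral_eq_integral[of "{0..t}" v] by (simp add: has_integral_iff)
    then show ?thesis
      by (auto simp: algebra_simps dest: has_integral_unique)
  qed
  then show ?thesis
    unfolding H1_deriv_def L2_deriv_def by blast
qed

lemma L2_deriv_integrable:
  assumes v: "L2_deriv a b q v" and st: "a \<le> s" "t \<le> b"
  shows "v integrable_on {s..t}" "(\<lambda>t. norm (v t)) integrable_on {s..t}"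
    and "(\<lambda>t. (norm (v t))\<^sup>2) integrable_on {s..t}"
proof -
  have "set_integrable lborel {s..t} v" "set_integrable lborel {s..t} (\<lambda>t. (norm (v t))\<^sup>2)"
    by (rule set_integrable_subset[OF L2_derivD(1)[OF v]] set_integrable_subset[OF L2_derivD(2)[OF v]];
        use st in simp)+
  then show "v integrable_on {s..t}" "(\<lambda>t. norm (v t)) integrable_on {s..t}"
    "(\<lambda>t. (norm (v t))\<^sup>2) integrable_on {s..t}"
    by (auto intro: set_borel_integral_eq_integral(1) set_integrable_norm)
qed

lemma L2_deriv_has_integral:
  assumes v: "L2_deriv a b q v" and st: "a \<le> s" "s \<le> t" "t \<le> b"
  shows "(v has_integral q t - q s) {s..t}"
proof -
  have "integral {a..s} v + integral {s..t} v = integral {a..t} v"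
    using st by (intro Henstock_Kurzweil_Integration.integral_combine L2_deriv_integrable[OF v]) auto
  moreover have "integral {a..s} v = q s - q a" "integral {a..t} v = q t - q a"
    using st by (auto intro!: integral_unique L2_derivD(3)[OF v])
  ultimately have "integral {s..t} v = q t - q s"
    by (simp add: algebra_simps)
  with L2_deriv_integrable(1)[OF v st(1,3)] show ?thesis
    by (simp add: has_integral_iff)
qed

lemma L2_deriv_subinterval:
  assumes v: "L2_deriv a b q v" and st: "a \<le> s" "t \<le> b"
  shows "L2_deriv s t q v"
  unfolding L2_deriv_def
  using L2_deriv_has_integral[OF v st(1)] st
  by (auto intro: set_integrable_subset[OF L2_derivD(1)[OF v]] set_integrable_subset[OF L2_derivD(2)[OF v]])

lemma L2_deriv_continuous:
  assumes v: "L2_deriv a b q v"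
  shows "continuous_on {a..b} q"
proof -
  have "continuous_on {a..b} (\<lambda>t. q a + integral {a..t} v)"
    by (intro continuous_intros indefinite_integral_continuous_1 L2_deriv_integrable[OF v]) auto
  then show ?thesis
    by (rule continuous_on_eq) (simp add: integral_unique[OF L2_derivD(3)[OF v]])
qed

lemma L2_deriv_cong:
  assumes "L2_deriv a b q v" and "\<And>t. t \<in> {a..b} \<Longrightarrow> q t = q' t"
  shows "L2_deriv a b q' v"
  using assms unfolding L2_deriv_def by (auto simp: order_trans)

lemma L2_deriv_bounded_linear:
  fixes f :: "'a::euclidean_space \<Rightarrow> 'b::euclidean_space"
  assumes f: "bounded_linear f" and v: "L2_deriv a b q v"
  shows "L2_deriv a b (\<lambda>t. f (q t)) (\<lambda>t. f (v t))"
proof -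
  interpret f: bounded_linear f by (rule f)
  obtain K where K: "\<And>x. norm (f x) \<le> norm x * K"
    using f.bounded by blast
  have "(\<lambda>t. indicator {a..b} t *\<^sub>R f (v t)) = (\<lambda>t. f (indicator {a..b} t *\<^sub>R v t))"
    by (simp add: f.scaleR)
  then have fv: "set_integrable lborel {a..b} (\<lambda>t. f (v t))"
    using integrable_bounded_linear[OF f] L2_derivD(1)[OF v] by (simp add: set_integrable_def)
  have "(norm (f x))\<^sup>2 \<le> K\<^sup>2 * (norm x)\<^sup>2" for x
    using power_mono[OF K, of x 2] by (simp add: power_mult_distrib mult.commute)
  then have "set_integrable lborel {a..b} (\<lambda>t. (norm (f (v t)))\<^sup>2)"
    by (intro set_integrable_norm_power2_bound[OF fv set_integrable_mult_right[OF L2_derivD(2)[OF v]]])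
  moreover have "((\<lambda>t. f (v t)) has_integral f (q t) - f (q a)) {a..t}" if "t \<in> {a..b}" for t
    using has_integral_linear[OF L2_derivD(3)[OF v that] f] by (simp add: o_def f.diff)
  ultimately show ?thesis
    using fv by (simp add: L2_deriv_def)
qed

lemma L2_deriv_add:
  assumes v: "L2_deriv a b q v" and w: "L2_deriv a b p w"
  shows "L2_deriv a b (\<lambda>t. q t + p t) (\<lambda>t. v t + w t)"
proof -
  have vw: "set_integrable lborel {a..b} (\<lambda>t. v t + w t)"
    by (intro set_integral_add L2_derivD(1)[OF v] L2_derivD(1)[OF w])
  have "(norm (x + y))\<^sup>2 \<le> 2 * (norm x)\<^sup>2 + 2 * (norm y)\<^sup>2" for x y :: 'a
    using power_mono[OF norm_triangle_ineq[of x y], of 2] sum_squares_bound[of "norm x" "norm y"]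
    by (simp add: power2_sum)
  moreover have "set_integrable lborel {a..b} (\<lambda>t. 2 * (norm (v t))\<^sup>2 + 2 * (norm (w t))\<^sup>2)"
    using L2_derivD(2)[OF v] L2_derivD(2)[OF w] by (intro set_integral_add(1)) auto
  ultimately have "set_integrable lborel {a..b} (\<lambda>t. (norm (v t + w t))\<^sup>2)"
    by (intro set_integrable_norm_power2_bound[OF vw])
  moreover have "((\<lambda>t. v t + w t) has_integral q t + p t - (q a + p a)) {a..t}" if "t \<in> {a..b}" for t
    using has_integral_add[OF L2_derivD(3)[OF v that] L2_derivD(3)[OF w that]]
    by (simp add: algebra_simps)
  ultimately show ?thesis
    using vw by (simp add: L2_deriv_def)
qed

lemma L2_deriv_mult_integrable:
  fixes v w :: "real \<Rightarrow> real"
  assumes v: "L2_deriv a b q v" and w: "L2_deriv a b p w"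
  shows "(\<lambda>t. v t * w t) integrable_on {a..b}"
proof -
  have "(\<lambda>t. ((norm (v t + w t))\<^sup>2 - (norm (v t))\<^sup>2 - (norm (w t))\<^sup>2) / 2) integrable_on {a..b}"
    by (intro integrable_on_divide integrable_diff L2_deriv_integrable(3)[OF L2_deriv_add[OF v w]]
        L2_deriv_integrable(3)[OF v] L2_deriv_integrable(3)[OF w] order_refl)
  then show ?thesis
    by (simp add: power2_eq_square algebra_simps)
qed

lemma integral_power2_add_scaled:
  fixes v w :: "real \<Rightarrow> real"
  assumes v: "L2_deriv a b q v" and w: "L2_deriv a b p w"
  shows "integral {a..b} (\<lambda>t. (v t + e * w t)\<^sup>2 / 2) = integral {a..b} (\<lambda>t. (v t)\<^sup>2 / 2)
    + e * integral {a..b} (\<lambda>t. v t * w t) + e\<^sup>2 * integral {a..b} (\<lambda>t. (w t)\<^sup>2 / 2)"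
proof -
  have square_integrable: "(\<lambda>t. (f t)\<^sup>2 / 2) integrable_on {a..b}" if "L2_deriv a b g f" for f g :: "real \<Rightarrow> real"
    using integrable_on_divide[OF L2_deriv_integrable(3)[OF that order_refl order_refl], of 2] by simp
  have "((\<lambda>t. (v t)\<^sup>2 / 2 + e * (v t * w t) + e\<^sup>2 * ((w t)\<^sup>2 / 2)) has_integral
      integral {a..b} (\<lambda>t. (v t)\<^sup>2 / 2) + e * integral {a..b} (\<lambda>t. v t * w t)
      + e\<^sup>2 * integral {a..b} (\<lambda>t. (w t)\<^sup>2 / 2)) {a..b}"
    by (intro has_integral_add has_integral_mult_right integrable_integral
        square_integrable[OF v] square_integrable[OF w] L2_deriv_mult_integrable[OF v w])
  moreover have "(v t)\<^sup>2 / 2 + e * (v t * w t) + e\<^sup>2 * ((w t)\<^sup>2 / 2) = (v t + e * w t)\<^sup>2 / 2" for t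
    by (simp add: power2_eq_square field_simps)
  ultimately show ?thesis
    by (simp only: integral_unique)
qed

lemma L2_deriv_glue:
  assumes q: "L2_deriv a b q v" and p: "L2_deriv b c p w"
    and b: "a \<le> b" "b \<le> c" "q b = p b"
  shows "L2_deriv a c (\<lambda>t. if t \<le> b then q t else p t) (\<lambda>t. if t \<le> b then v t else w t)"
proof -
  have "set_integrable lborel {a..c} (\<lambda>t. if t \<le> b then v t else w t)"
    by (intro set_integrable_If_le L2_derivD(1)[OF q] L2_derivD(1)[OF p] b)
  moreover have "set_integrable lborel {a..c} (\<lambda>t. (norm (if t \<le> b then v t else w t))\<^sup>2)"
    using set_integrable_If_le[OF L2_derivD(2)[OF q] L2_derivD(2)[OF p] b(1,2)]
    by (simp add: if_distrib[of "\<lambda>x. (norm x)\<^sup>2"])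
  moreover have "((\<lambda>t. if t \<le> b then v t else w t) has_integral
      (if t \<le> b then q t else p t) - q a) {a..t}" if t: "t \<in> {a..c}" for t
  proof (cases "t \<le> b")
    case True
    then show ?thesis
      using has_integral_eq[OF _ L2_derivD(3)[OF q, of t]] t by simp
  next
    case False
    have "((\<lambda>t. if t \<le> b then v t else w t) has_integral (q b - q a) + (p t - p b)) {a..t}"
      using False b t by (intro has_integral_If_le L2_derivD(3)[OF q] L2_derivD(3)[OF p]) auto
    then show ?thesis using False b(3) by simp
  qed
  ultimately show ?thesis
    using b(1) by (simp add: L2_deriv_def)
qed

lemma L2_deriv_unique:
  assumes "L2_deriv a b q v" "L2_deriv a b q w"
  shows "AE t in lborel. t \<in> {a..b} \<longrightarrow> v t = w t"
proof -
  define f where "f = (\<lambda>t. indicator {a..b} t *\<^sub>R (v t - w t))"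
  have vw: "set_integrable lborel {a..b} (\<lambda>t. v t - w t)"
    using assms by (intro set_integral_diff L2_derivD(1))
  then have f: "integrable lborel f"
    by (simp add: f_def set_integrable_def)
  have "(LINT x:{..c}|lborel. f x) = 0" for c
  proof (cases "a \<le> min b c")
    case True
    then have c: "min b c \<in> {a..b}" by simp
    have "(LINT x:{..c}|lborel. f x) = (LINT x:{a..min b c}|lborel. v x - w x)"
      unfolding set_lebesgue_integral_def
      by (intro Bochner_Integration.integral_cong) (auto simp: f_def indicator_def)
    also have "\<dots> = integral {a..min b c} (\<lambda>x. v x - w x)"
      by (intro set_borel_integral_eq_integral set_integrable_subset[OF vw]) auto
    also have "\<dots> = 0"
      using has_integral_diff[OF L2_derivD(3)[OF assms(1) c] L2_derivD(3)[OF assms(2) c]]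
      by (simp add: integral_unique)
    finally show ?thesis .
  next
    case False
    then have "(\<lambda>x. indicator {..c} x *\<^sub>R f x) = (\<lambda>x. 0)"
      by (auto simp: f_def indicator_def)
    then show ?thesis by (simp add: set_lebesgue_integral_def)
  qed
  from AE_zero_if_integral_atMost_zero[OF f this] show ?thesis
    by eventually_elim (auto simp: f_def)
qed

section \<open>The value of the action\<close>

text \<open>As \<open>1 / 0 = 0\<close>, integrability alone would not exclude a collision set of positive measure.\<close>

definition finite_potential :: "real set \<Rightarrow> (real \<Rightarrow> 'a::real_normed_vector) \<Rightarrow> bool" where
  "finite_potential A q \<longleftrightarrow>
     set_integrable lborel A (\<lambda>t. 1 / norm (q t)) \<and> (AE t in lborel. t \<in> A \<longrightarrow> q t \<noteq> 0)"

lemma finite_potentialD: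
  assumes "finite_potential A q"
  shows "set_integrable lborel A (\<lambda>t. 1 / norm (q t))" "AE t in lborel. t \<in> A \<longrightarrow> q t \<noteq> 0"
  using assms unfolding finite_potential_def by blast+

lemma finite_potential_subset:
  assumes q: "finite_potential A q" and B: "B \<subseteq> A" "B \<in> sets borel"
  shows "finite_potential B q"
  unfolding finite_potential_def
proof
  show "set_integrable lborel B (\<lambda>t. 1 / norm (q t))"
    using finite_potentialD(1)[OF q] by (rule set_integrable_subset) (use B in auto)
  show "AE t in lborel. t \<in> B \<longrightarrow> q t \<noteq> 0"
    using finite_potentialD(2)[OF q] by eventually_elim (use B in auto)
qed

lemma finite_potential_integrable:
  assumes "finite_potential {a..b} q" and "a \<le> s" "t \<le> b"
  shows "(\<lambda>t. 1 / norm (q t)) integrable_on {s..t}"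
proof -
  have "(\<lambda>t. 1 / norm (q t)) integrable_on {a..b}"
    using finite_potentialD(1)[OF assms(1)] by (rule set_borel_integral_eq_integral)
  then show ?thesis
    by (rule integrable_on_subinterval) (use assms(2,3) in auto)
qed

lemma finite_potential_negligible:
  assumes "finite_potential A q"
  shows "negligible {t \<in> A. q t = 0}"
proof -
  obtain N where N: "N \<in> null_sets lborel" "\<And>t. t \<notin> N \<Longrightarrow> t \<in> A \<longrightarrow> q t \<noteq> 0"
    using AE_E3[OF finite_potentialD(2)[OF assms]] by auto
  then have "negligible N"
    by (simp add: negligible_iff_null_sets null_sets_completionI)
  then show ?thesis
    by (rule negligible_subset) (use N(2) in auto)
qed

lemma finite_potential_cong_norm:
  assumes "\<And>t. t \<in> A \<Longrightarrow> norm (q t) = norm (p t)"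
  shows "finite_potential A q \<longleftrightarrow> finite_potential A p"
proof -
  have "set_integrable lborel A (\<lambda>t. 1 / norm (q t)) \<longleftrightarrow> set_integrable lborel A (\<lambda>t. 1 / norm (p t))"
    by (intro set_integrable_cong) (simp_all add: assms)
  moreover have "(t \<in> A \<longrightarrow> q t \<noteq> 0) \<longleftrightarrow> (t \<in> A \<longrightarrow> p t \<noteq> 0)" for t
    using assms[of t] by (metis norm_eq_zero)
  ultimately show ?thesis
    unfolding finite_potential_def by simp
qed

lemma finite_potential_if_nonzero:
  fixes q :: "real \<Rightarrow> 'a::real_normed_vector"
  assumes "continuous_on {a..b} q" and "\<And>t. t \<in> {a..b} \<Longrightarrow> q t \<noteq> 0"
  shows "finite_potential {a..b} q"
  unfolding finite_potential_def using assms
  by (auto intro!: borel_integrable_atLeastAtMost' continuous_intros)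

lemma set_borel_measurable_inverse_norm:
  fixes q :: "real \<Rightarrow> 'a::real_normed_vector"
  assumes "continuous_on A q" "A \<in> sets borel"
  shows "set_borel_measurable borel A (\<lambda>t. 1 / norm (q t))"
proof -
  have "(\<lambda>t. 1 / (indicator A t *\<^sub>R norm (q t))) \<in> borel_measurable borel"
    using assms
    by (intro borel_measurable_divide borel_measurable_const borel_measurable_continuous_on_indicator
        continuous_intros)
  also have "(\<lambda>t. 1 / (indicator A t *\<^sub>R norm (q t))) = (\<lambda>t. indicator A t *\<^sub>R (1 / norm (q t)))"
    by (auto simp: indicator_def)
  finally show ?thesis
    by (simp add: set_borel_measurable_def)
qed

lemma finite_potential_glue:
  assumes q: "finite_potential {a..b} q" and p: "finite_potential {b..c} p" and "a \<le> b" "b \<le> c"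
  shows "finite_potential {a..c} (\<lambda>t. if t \<le> b then q t else p t)"
proof -
  have "AE t in lborel. t \<in> {a..c} \<longrightarrow> (if t \<le> b then q t else p t) \<noteq> 0"
    using finite_potentialD(2)[OF q] finite_potentialD(2)[OF p] by eventually_elim auto
  moreover have "set_integrable lborel {a..c} (\<lambda>t. 1 / norm (if t \<le> b then q t else p t))"
    using set_integrable_If_le[OF finite_potentialD(1)[OF q] finite_potentialD(1)[OF p] assms(3,4)]
    by (simp add: if_distrib[of "\<lambda>x. 1 / norm x"])
  ultimately show ?thesis
    by (simp add: finite_potential_def)
qed

lemma integral_inverse_norm_mono:
  fixes p q :: "real \<Rightarrow> 'a::real_normed_vector"
  assumes p: "continuous_on {a..b} p" "\<And>t. t \<in> {a..b} \<Longrightarrow> p t \<noteq> 0"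
    and q: "finite_potential {a..b} q" and le: "\<And>t. t \<in> {a..b} \<Longrightarrow> norm (q t) \<le> norm (p t)"
  shows "integral {a..b} (\<lambda>t. 1 / norm (p t)) \<le> integral {a..b} (\<lambda>t. 1 / norm (q t))"
proof -
  let ?f = "\<lambda>t. if q t = 0 then 0 else 1 / norm (p t)"
  note collisions = finite_potential_negligible[OF q]
  have "(\<lambda>t. 1 / norm (p t)) integrable_on {a..b}"
    using p by (intro integrable_continuous_real continuous_intros) auto
  then have "?f integrable_on {a..b}"
    by (rule integrable_spike[OF _ collisions]) auto
  moreover have "integral {a..b} (\<lambda>t. 1 / norm (p t)) = integral {a..b} ?f"
    by (rule integral_spike[OF collisions]) auto
  moreover have "?f t \<le> 1 / norm (q t)" if "t \<in> {a..b}" for t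
    using le[OF that] p(2)[OF that] by (simp add: frac_le)
  ultimately show ?thesis
    using integral_le[OF _ finite_potential_integrable[OF q order_refl order_refl], of ?f] by simp
qed

definition real_action :: "real \<Rightarrow> (real \<Rightarrow> real \<times> real) \<Rightarrow> (real \<Rightarrow> real \<times> real) \<Rightarrow> real" where
  "real_action T q v = integral {0..T} (\<lambda>t. (norm (v t))\<^sup>2 / 2)
     + integral {0..T} (\<lambda>t. 1 / norm (q t)) + integral {0..T} (\<lambda>t. fst (q t))"

lemma action_eq_action_with:
  assumes "H1_deriv T q v"
  shows "action T q = action_with T q v"
proof -
  define u where "u = (SOME v. H1_deriv T q v)"
  have "H1_deriv T q u"
    unfolding u_def by (rule someI[of "H1_deriv T q", OF assms])
  then have "AE t in lborel. t \<in> {0..T} \<longrightarrow> u t = v t"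
    using assms unfolding H1_deriv_iff_L2_deriv by (rule L2_deriv_unique)
  then have "AE t in lborel. (ennreal ((norm (u t))\<^sup>2 / 2)
        + (if q t = 0 then \<infinity> else ennreal (1 / norm (q t)))) * indicator {0..T} t
      = (ennreal ((norm (v t))\<^sup>2 / 2)
        + (if q t = 0 then \<infinity> else ennreal (1 / norm (q t)))) * indicator {0..T} t"
    by eventually_elim (simp add: indicator_def)
  then show ?thesis
    unfolding action_def action_with_def u_def[symmetric] by (simp only: nn_integral_cong_AE)
qed

lemma finite_potential_if_action_finite:
  assumes v: "H1_deriv T q v" and finite: "action T q < \<infinity>"
  shows "finite_potential {0..T} q"
proof -
  define g :: "real \<Rightarrow> ennreal" where "g t = (if q t = 0 then \<infinity> else ennreal (1 / norm (q t)))" for t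
  have q: "continuous_on {0..T} q"
    using v by (auto simp: H1_deriv_iff_L2_deriv intro: L2_deriv_continuous)
  have [measurable]: "(\<lambda>t. indicator {0..T} t *\<^sub>R q t) \<in> borel_measurable borel"
    using q by (intro borel_measurable_continuous_on_indicator) auto
  have "(\<lambda>t. g t * indicator {0..T} t) = (\<lambda>t. (if indicator {0..T} t *\<^sub>R q t = 0 then \<infinity>
      else ennreal (1 / norm (indicator {0..T} t *\<^sub>R q t))) * indicator {0..T} t)"
    by (auto simp: g_def indicator_def)
  also have "\<dots> \<in> borel_measurable lborel" by measurable
  finally have meas: "(\<lambda>t. g t * indicator {0..T} t) \<in> borel_measurable lborel" .
  have "(\<integral>\<^sup>+t. g t * indicator {0..T} t \<partial>lborel)
      \<le> (\<integral>\<^sup>+t\<in>{0..T}. (ennreal ((norm (v t))\<^sup>2 / 2) + g t) \<partial>lborel)"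
    by (intro nn_integral_mono) (auto simp: indicator_def)
  also have "\<dots> < \<infinity>"
    using finite unfolding action_eq_action_with[OF v] action_with_def g_def[symmetric]
    by (auto simp: less_top)
  finally have nn_finite: "(\<integral>\<^sup>+t. g t * indicator {0..T} t \<partial>lborel) < \<infinity>" .
  have "AE t in lborel. t \<in> {0..T} \<longrightarrow> q t \<noteq> 0"
    using finite_nn_integral_imp_ae_finite[OF meas nn_finite] by eventually_elim (auto simp: g_def)
  moreover have "set_integrable lborel {0..T} (\<lambda>t. 1 / norm (q t))"
    unfolding set_integrable_def
  proof (rule integrableI_bounded)
    show "(\<lambda>t. indicator {0..T} t *\<^sub>R (1 / norm (q t))) \<in> borel_measurable lborel"
      using set_borel_measurable_inverse_norm[OF q] by (simp add: set_borel_measurable_def)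
    have "(\<integral>\<^sup>+t. ennreal (norm (indicator {0..T} t *\<^sub>R (1 / norm (q t)))) \<partial>lborel)
        \<le> (\<integral>\<^sup>+t. g t * indicator {0..T} t \<partial>lborel)"
      by (intro nn_integral_mono) (auto simp: g_def indicator_def)
    with nn_finite show "(\<integral>\<^sup>+t. ennreal (norm (indicator {0..T} t *\<^sub>R (1 / norm (q t)))) \<partial>lborel) < \<infinity>"
      by order
  qed
  ultimately show ?thesis
    by (simp add: finite_potential_def)
qed

lemma action_eq_real_action:
  assumes v: "H1_deriv T q v" and q: "finite_potential {0..T} q"
  shows "action T q = ereal (real_action T q v)"
proof -
  let ?f = "\<lambda>t. (norm (v t))\<^sup>2 / 2 + 1 / norm (q t)"
  have L2: "L2_deriv 0 T q v"
    using v by (simp add: H1_deriv_iff_L2_deriv)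
  have kinetic: "(\<lambda>t. (norm (v t))\<^sup>2 / 2) integrable_on {0..T}"
    by (intro integrable_on_divide L2_deriv_integrable(3)[OF L2]) auto
  have potential: "(\<lambda>t. 1 / norm (q t)) integrable_on {0..T}"
    by (rule finite_potential_integrable[OF q]) auto
  have "(\<integral>\<^sup>+ t\<in>{0..T}. (ennreal ((norm (v t))\<^sup>2 / 2)
         + (if q t = 0 then \<infinity> else ennreal (1 / norm (q t)))) \<partial>lborel)
       = (\<integral>\<^sup>+ t. ennreal (?f t) * indicator {0..T} t \<partial>lborel)"
    by (rule nn_integral_cong_AE, use finite_potentialD(2)[OF q] in eventually_elim)
      (simp add: indicator_def)
  also have "\<dots> = ennreal (integral {0..T} ?f)"
    by (intro nn_integral_has_integral_lebesgue' integrable_integral integrable_add kinetic potential) auto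
  finally have "enn2ereal (\<integral>\<^sup>+ t\<in>{0..T}. (ennreal ((norm (v t))\<^sup>2 / 2)
         + (if q t = 0 then \<infinity> else ennreal (1 / norm (q t)))) \<partial>lborel)
      = ereal (integral {0..T} ?f)"
    by (simp only:) (intro enn2ereal_ennreal integral_nonneg integrable_add kinetic potential; simp)
  moreover have "integral {0..T} ?f
      = integral {0..T} (\<lambda>t. (norm (v t))\<^sup>2 / 2) + integral {0..T} (\<lambda>t. 1 / norm (q t))"
    by (intro integral_add kinetic potential)
  moreover have "(LINT t:{0..T}|lborel. fst (q t)) = integral {0..T} (\<lambda>t. fst (q t))"
    by (intro set_borel_integral_eq_integral borel_integrable_atLeastAtMost' continuous_intros
        L2_deriv_continuous[OF L2])
  ultimately show ?thesis
    unfolding action_eq_action_with[OF v] action_with_def real_action_def by simp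
qed

section \<open>Paths on the negative axis\<close>

definition radial_path :: "real \<Rightarrow> real \<Rightarrow> (real \<Rightarrow> real) \<Rightarrow> (real \<Rightarrow> real) \<Rightarrow> bool" where
  "radial_path a b r v \<longleftrightarrow>
     L2_deriv a b r v \<and> finite_potential {a..b} r \<and> (\<forall>t\<in>{a..b}. 0 \<le> r t)"

definition radial_action :: "real \<Rightarrow> real \<Rightarrow> (real \<Rightarrow> real) \<Rightarrow> (real \<Rightarrow> real) \<Rightarrow> real" where
  "radial_action a b r v = integral {a..b} (\<lambda>t. (v t)\<^sup>2 / 2)
     + integral {a..b} (\<lambda>t. 1 / r t) - integral {a..b} r"

lemma radial_pathD:
  assumes "radial_path a b r v"
  shows "L2_deriv a b r v" "finite_potential {a..b} r" "t \<in> {a..b} \<Longrightarrow> 0 \<le> r t"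
  using assms unfolding radial_path_def by blast+

lemma radial_path_integrable:
  assumes "radial_path a b r v"
  shows "(\<lambda>t. (v t)\<^sup>2) integrable_on {a..b}" "(\<lambda>t. 1 / r t) integrable_on {a..b}"
    and "r integrable_on {a..b}"
proof -
  note r = radial_pathD[OF assms]
  show "(\<lambda>t. (v t)\<^sup>2) integrable_on {a..b}"
    using L2_deriv_integrable(3)[OF r(1), of a b] by simp
  show "(\<lambda>t. 1 / r t) integrable_on {a..b}"
    using r(3) by (intro integrable_eq[OF finite_potential_integrable[OF r(2)]]) auto
  show "r integrable_on {a..b}"
    by (intro integrable_continuous_real L2_deriv_continuous[OF r(1)])
qed

lemma radial_path_subinterval:
  assumes "radial_path a b r v" and "a \<le> s" "t \<le> b"
  shows "radial_path s t r v"
  using assms unfolding radial_path_def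
  by (auto intro: L2_deriv_subinterval finite_potential_subset)

lemma radial_path_const: "c > 0 \<Longrightarrow> radial_path a b (\<lambda>t. c) (\<lambda>t. 0)"
  by (auto simp: radial_path_def intro!: L2_deriv_const finite_potential_if_nonzero)

lemma radial_path_add_scaled:
  assumes r: "L2_deriv a b r v" and \<phi>: "L2_deriv a b \<phi> w"
    and pos: "\<And>t. t \<in> {a..b} \<Longrightarrow> r t + e * \<phi> t > 0"
  shows "radial_path a b (\<lambda>t. r t + e * \<phi> t) (\<lambda>t. v t + e * w t)"
proof -
  have "L2_deriv a b (\<lambda>t. r t + e * \<phi> t) (\<lambda>t. v t + e * w t)"
    using r by (rule L2_deriv_add) (rule L2_deriv_bounded_linear[OF bounded_linear_mult_right \<phi>])
  moreover from this have "finite_potential {a..b} (\<lambda>t. r t + e * \<phi> t)"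
    using pos by (intro finite_potential_if_nonzero L2_deriv_continuous) force+
  ultimately show ?thesis
    using pos by (simp add: radial_path_def less_imp_le)
qed

lemma radial_path_glue:
  assumes r: "radial_path a b r v" and s: "radial_path b c s w"
    and b: "a \<le> b" "b \<le> c" "r b = s b"
  defines "R \<equiv> \<lambda>t. if t \<le> b then r t else s t" and "V \<equiv> \<lambda>t. if t \<le> b then v t else w t"
  shows "radial_path a c R V"
    and "radial_action a c R V = radial_action a b r v + radial_action b c s w"
proof -
  note r' = radial_pathD[OF r] and s' = radial_pathD[OF s]
  show "radial_path a c R V"
    unfolding radial_path_def R_def V_def
    using L2_deriv_glue[OF r'(1) s'(1) b] finite_potential_glue[OF r'(2) s'(2) b(1,2)] r'(3) s'(3)
    by auto
  note int = radial_path_integrable[OF r] radial_path_integrable[OF s]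
  have "integral {a..c} (\<lambda>t. (V t)\<^sup>2 / 2)
      = integral {a..b} (\<lambda>t. (v t)\<^sup>2 / 2) + integral {b..c} (\<lambda>t. (w t)\<^sup>2 / 2)"
    unfolding V_def if_distrib[of "\<lambda>x. x\<^sup>2 / 2"] by (intro integral_If_le integrable_on_divide int b)
  moreover have "integral {a..c} (\<lambda>t. 1 / R t)
      = integral {a..b} (\<lambda>t. 1 / r t) + integral {b..c} (\<lambda>t. 1 / s t)"
    unfolding R_def if_distrib[of "\<lambda>x. 1 / x"] by (intro integral_If_le int b)
  moreover have "integral {a..c} R = integral {a..b} r + integral {b..c} s"
    unfolding R_def by (intro integral_If_le int b)
  ultimately show "radial_action a c R V = radial_action a b r v + radial_action b c s w"
    by (simp add: radial_action_def)
qed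

lemma radial_action_combine:
  assumes r: "radial_path a c r v" and b: "a \<le> b" "b \<le> c"
  shows "radial_action a b r v + radial_action b c r v = radial_action a c r v"
  unfolding radial_action_def
  using Henstock_Kurzweil_Integration.integral_combine[OF b radial_path_integrable(1)[OF r]]
    Henstock_Kurzweil_Integration.integral_combine[OF b radial_path_integrable(2)[OF r]]
    Henstock_Kurzweil_Integration.integral_combine[OF b radial_path_integrable(3)[OF r]]
  by simp

lemma radial_action_const_less:
  assumes r: "radial_path a b r v" and c: "c > 0" and le: "\<And>t. t \<in> {a..b} \<Longrightarrow> r t \<le> c"
    and u: "u \<in> {a..b}" "r u < c" and ab: "a < b"
  shows "radial_action a b (\<lambda>t. c) (\<lambda>t. 0) < radial_action a b r v"
proof -
  have "0 \<le> integral {a..b} (\<lambda>t. (v t)\<^sup>2 / 2)"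
    by (intro integral_nonneg integrable_on_divide radial_path_integrable(1)[OF r]) auto
  moreover have "integral {a..b} (\<lambda>t. 1 / norm c) \<le> integral {a..b} (\<lambda>t. 1 / norm (r t))"
    using c le radial_pathD(3)[OF r] by (intro integral_inverse_norm_mono radial_pathD(2)[OF r]) auto
  moreover have "integral {a..b} (\<lambda>t. 1 / norm (r t)) = integral {a..b} (\<lambda>t. 1 / r t)"
    using radial_pathD(3)[OF r] by (intro integral_cong) auto
  moreover have "integral {a..b} r < integral {a..b} (\<lambda>t. c)"
  proof -
    have cont: "continuous_on {a..b} (\<lambda>t. c - r t)"
      by (intro continuous_intros L2_deriv_continuous[OF radial_pathD(1)[OF r]])
    have "0 \<le> integral {a..b} (\<lambda>t. c - r t)"
      using le by (intro integral_nonneg integrable_continuous_real cont) auto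
    moreover have "integral {a..b} (\<lambda>t. c - r t) \<noteq> 0"
      using ab u le cont by (subst integral_eq_0_iff) force+
    moreover have "integral {a..b} (\<lambda>t. c - r t) = integral {a..b} (\<lambda>t. c) - integral {a..b} r"
      by (intro integral_diff radial_path_integrable(3)[OF r]) auto
    ultimately show ?thesis by linarith
  qed
  ultimately show ?thesis
    using c by (simp add: radial_action_def)
qed

lemma H1_deriv_radial_path:
  assumes "radial_path 0 T r v"
  shows "H1_deriv T (\<lambda>t. (- r t, 0)) (\<lambda>t. (- v t, 0))"
proof -
  have "bounded_linear (\<lambda>x::real. (- x, 0::real))"
    by (intro bounded_linear_Pair bounded_linear_minus bounded_linear_ident bounded_linear_zero)
  from L2_deriv_bounded_linear[OF this radial_pathD(1)[OF assms]] show ?thesis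
    by (simp add: H1_deriv_iff_L2_deriv)
qed

lemma action_radial_path:
  assumes r: "radial_path 0 T r v"
  shows "action T (\<lambda>t. (- r t, 0)) = ereal (radial_action 0 T r v)"
proof -
  have "finite_potential {0..T} (\<lambda>t. (- r t, 0::real))"
    using radial_pathD(2)[OF r] by (subst finite_potential_cong_norm[of _ _ r]) (auto simp: norm_Pair)
  then have "action T (\<lambda>t. (- r t, 0)) = ereal (real_action T (\<lambda>t. (- r t, 0)) (\<lambda>t. (- v t, 0)))"
    by (rule action_eq_real_action[OF H1_deriv_radial_path[OF r]])
  also have "integral {0..T} (\<lambda>t. 1 / norm (- r t, 0::real)) = integral {0..T} (\<lambda>t. 1 / r t)"
    using radial_pathD(3)[OF r] by (intro integral_cong) (auto simp: norm_Pair)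
  then have "real_action T (\<lambda>t. (- r t, 0)) (\<lambda>t. (- v t, 0)) = radial_action 0 T r v"
    by (simp add: real_action_def radial_action_def norm_Pair)
  finally show ?thesis .
qed

definition radial_lower_bound :: "real \<Rightarrow> real \<Rightarrow> bool" where
  "radial_lower_bound T m \<longleftrightarrow>
     (\<forall>r v. radial_path 0 T r v \<and> r 0 = 0 \<longrightarrow> m \<le> radial_action 0 T r v)"

lemma radial_lower_boundD:
  "\<lbrakk>radial_lower_bound T m; radial_path 0 T r v; r 0 = 0\<rbrakk> \<Longrightarrow> m \<le> radial_action 0 T r v"
  unfolding radial_lower_bound_def by blast

lemma action_minimizer_le_radial_action:
  assumes q: "global_minimizer T q" and T: "T \<ge> 0" and r: "radial_path 0 T r v" "r 0 = 0"
  shows "action T q \<le> ereal (radial_action 0 T r v)"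
proof -
  have "(\<lambda>t. (- r t, 0)) \<in> Omega T"
    using H1_deriv_radial_path[OF r(1)] radial_pathD(3)[OF r(1), of T] r(2) T
    by (auto simp: Omega_def H1_def)
  then show ?thesis
    using q action_radial_path[OF r(1)] by (metis global_minimizer_def)
qed

lemma radial_lower_bound_minimizer:
  assumes "global_minimizer T q" "T \<ge> 0" "action T q = ereal m"
  shows "radial_lower_bound T m"
  unfolding radial_lower_bound_def
  using action_minimizer_le_radial_action[OF assms(1,2)] assms(3) by auto

lemma action_cong:
  assumes v: "H1_deriv T q v" and eq: "\<And>t. t \<in> {0..T} \<Longrightarrow> q t = p t"
  shows "action T q = action T p"
proof -
  have p: "H1_deriv T p v"
    using v eq unfolding H1_deriv_iff_L2_deriv by (rule L2_deriv_cong)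
  have "action_with T q v = action_with T p v"
    unfolding action_with_def
    by (intro arg_cong2[where f="(+)"] arg_cong[where f=enn2ereal] arg_cong[where f=ereal]
        nn_integral_cong set_lebesgue_integral_cong) (auto simp: eq indicator_def)
  then show ?thesis
    by (simp add: action_eq_action_with[OF v] action_eq_action_with[OF p])
qed

lemma radial_path_if_on_negative_axis:
  assumes v: "H1_deriv T q v" and finite: "action T q < \<infinity>"
    and axis: "\<And>t. t \<in> {0..T} \<Longrightarrow> snd (q t) = 0 \<and> fst (q t) \<le> 0"
  shows "radial_path 0 T (\<lambda>t. - fst (q t)) (\<lambda>t. - fst (v t))"
    and "action T q = ereal (radial_action 0 T (\<lambda>t. - fst (q t)) (\<lambda>t. - fst (v t)))"
proof -
  have norm_q: "norm (- fst (q t)) = norm (q t)" if "t \<in> {0..T}" for t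
    using axis[OF that] by (simp add: norm_prod_def)
  have "bounded_linear (\<lambda>x::real \<times> real. - fst x)"
    by (intro bounded_linear_minus bounded_linear_fst)
  from L2_deriv_bounded_linear[OF this v[unfolded H1_deriv_iff_L2_deriv]]
  have "L2_deriv 0 T (\<lambda>t. - fst (q t)) (\<lambda>t. - fst (v t))" .
  moreover have "finite_potential {0..T} (\<lambda>t. - fst (q t))"
    using finite_potential_if_action_finite[OF v finite]
    by (subst finite_potential_cong_norm[OF norm_q])
  ultimately show r: "radial_path 0 T (\<lambda>t. - fst (q t)) (\<lambda>t. - fst (v t))"
    using axis by (simp add: radial_path_def)
  have "q t = (- (- fst (q t)), 0)" if "t \<in> {0..T}" for t
    using axis[OF that] by (simp add: prod_eq_iff)
  from action_cong[OF v this]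
  show "action T q = ereal (radial_action 0 T (\<lambda>t. - fst (q t)) (\<lambda>t. - fst (v t)))"
    by (simp only: action_radial_path[OF r])
qed

section \<open>Polygonal competitors\<close>

lemma cube_powr:
  fixes x p :: real
  assumes "x \<ge> 0" "p \<noteq> 0"
  shows "(x ^ 3) powr p = x powr (3 * p)"
  using powr_powr[of x 3 p] assms by (cases "x = 0") simp_all

text \<open>The square root of the distance runs linearly from \<open>\<alpha>\<close> to \<open>\<beta>\<close> in Levi-Civita time \<open>D\<close>, so its
  cube is linear in \<open>t\<close>.\<close>

locale kepler_arc =
  fixes \<alpha> \<beta> D A :: real
  assumes \<alpha>_nonneg: "\<alpha> \<ge> 0" and \<beta>_pos: "\<beta> > 0" and D_pos: "D > 0"
begin

definition duration :: real where
  "duration = D * (\<alpha>\<^sup>2 + \<alpha> * \<beta> + \<beta>\<^sup>2) / 3"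

definition cube :: "real \<Rightarrow> real" where
  "cube t = \<alpha> ^ 3 + 3 * (\<beta> - \<alpha>) / D * (t - A)"

definition radius :: "real \<Rightarrow> real" where
  "radius t = cube t powr (2/3)"

definition speed :: "real \<Rightarrow> real" where
  "speed t = 2 * (\<beta> - \<alpha>) / D * cube t powr (-1/3)"

lemma duration_pos: "duration > 0"
  unfolding duration_def using \<alpha>_nonneg \<beta>_pos D_pos by (simp add: add_nonneg_pos)

lemma cube_start: "cube A = \<alpha> ^ 3"
  by (simp add: cube_def)

lemma cube_end: "cube (A + duration) = \<beta> ^ 3"
proof -
  have "3 * (\<beta> - \<alpha>) / D * duration = (\<beta> - \<alpha>) * (\<alpha>\<^sup>2 + \<alpha> * \<beta> + \<beta>\<^sup>2)"
    using D_pos by (simp add: duration_def)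
  also have "\<dots> = \<beta> ^ 3 - \<alpha> ^ 3"
    by (simp add: algebra_simps power2_eq_square power3_eq_cube)
  finally show ?thesis by (simp add: cube_def)
qed

lemma cube_convex_combination:
  "cube t = (1 - (t - A) / duration) * \<alpha> ^ 3 + (t - A) / duration * \<beta> ^ 3"
proof -
  have "3 * (\<beta> - \<alpha>) / D * duration = \<beta> ^ 3 - \<alpha> ^ 3"
    using cube_end by (simp add: cube_def)
  then have "3 * (\<beta> - \<alpha>) / D = (\<beta> ^ 3 - \<alpha> ^ 3) / duration"
    using duration_pos by (simp add: field_simps)
  then have "cube t = \<alpha> ^ 3 + (\<beta> ^ 3 - \<alpha> ^ 3) / duration * (t - A)"
    unfolding cube_def by (simp only:)
  then show ?thesis by (simp add: algebra_simps diff_divide_distrib)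
qed

lemma cube_pos: "cube t > 0" if "t \<in> {A<..A + duration}"
proof -
  have "(1 - (t - A) / duration) * \<alpha> ^ 3 \<ge> 0"
    using that duration_pos \<alpha>_nonneg by (intro mult_nonneg_nonneg) (auto simp: field_simps)
  moreover have "(t - A) / duration * \<beta> ^ 3 > 0"
    using that duration_pos \<beta>_pos by simp
  ultimately show ?thesis unfolding cube_convex_combination by simp
qed

lemma cube_ge: "cube t \<ge> min \<alpha> \<beta> ^ 3" if "t \<in> {A..A + duration}"
proof -
  define u where "u = (t - A) / duration"
  have u: "0 \<le> u" "u \<le> 1"
    using that duration_pos by (auto simp: u_def)
  have "min \<alpha> \<beta> ^ 3 \<le> \<alpha> ^ 3" "min \<alpha> \<beta> ^ 3 \<le> \<beta> ^ 3"
    using \<alpha>_nonneg \<beta>_pos by (auto intro!: power_mono)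
  then have "(1 - u) * min \<alpha> \<beta> ^ 3 \<le> (1 - u) * \<alpha> ^ 3" "u * min \<alpha> \<beta> ^ 3 \<le> u * \<beta> ^ 3"
    using u by (auto intro!: mult_left_mono)
  then show ?thesis
    unfolding cube_convex_combination u_def[symmetric] by (simp add: algebra_simps)
qed

lemma cube_nonneg: "cube t \<ge> 0" if "t \<in> {A..A + duration}"
  using \<alpha>_nonneg \<beta>_pos by (intro order_trans[OF zero_le_power cube_ge[OF that]]) simp

lemma radius_start: "radius A = \<alpha>\<^sup>2" and radius_end: "radius (A + duration) = \<beta>\<^sup>2"
  using \<alpha>_nonneg \<beta>_pos by (simp_all add: radius_def cube_start cube_end cube_powr)

lemma radius_nonneg: "radius t \<ge> 0"
  by (simp add: radius_def)

lemma radius_ge: "radius t \<ge> (min \<alpha> \<beta>)\<^sup>2" if "t \<in> {A..A + duration}"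
proof -
  have "(min \<alpha> \<beta>)\<^sup>2 = (min \<alpha> \<beta> ^ 3) powr (2/3)"
    using \<alpha>_nonneg \<beta>_pos by (subst cube_powr) auto
  also have "\<dots> \<le> radius t"
    unfolding radius_def using cube_ge[OF that] \<alpha>_nonneg \<beta>_pos by (intro powr_mono2) auto
  finally show ?thesis .
qed

lemma continuous_on_cube_powr: "continuous_on {A..A + duration} (\<lambda>t. cube t powr p)" if "p > 0"
  using that cube_nonneg
  by (intro continuous_on_powr') (use D_pos in \<open>auto simp: cube_def[abs_def] intro!: continuous_intros\<close>)

lemma has_derivative_cube_powr:
  assumes "t \<in> {A<..A + duration}"
  shows "((\<lambda>t. cube t powr p) has_real_derivative p * cube t powr (p - 1) * (3 * (\<beta> - \<alpha>) / D)) (at t)"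
proof -
  have "(cube has_real_derivative 3 * (\<beta> - \<alpha>) / D) (at t)"
    unfolding cube_def[abs_def] using D_pos by (auto intro!: derivative_eq_intros)
  from DERIV_chain2[OF has_real_derivative_powr[OF cube_pos[OF assms]] this] show ?thesis .
qed

lemma speed_has_integral:
  assumes "t \<in> {A..A + duration}"
  shows "(speed has_integral radius t - radius A) {A..t}"
proof (rule fundamental_theorem_of_calculus_interior)
  show "continuous_on {A..t} radius"
    unfolding radius_def[abs_def] using assms
    by (intro continuous_on_subset[OF continuous_on_cube_powr]) auto
  fix u assume "u \<in> {A<..<t}"
  then have "(radius has_real_derivative 2/3 * cube u powr (2/3 - 1) * (3 * (\<beta> - \<alpha>) / D)) (at u)"
    unfolding radius_def[abs_def] using assms by (intro has_derivative_cube_powr) auto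
  also have "2/3 * cube u powr (2/3 - 1) * (3 * (\<beta> - \<alpha>) / D) = speed u"
    using D_pos by (simp add: speed_def field_simps)
  finally show "(radius has_vector_derivative speed u) (at u)"
    by (simp add: has_real_derivative_iff_has_vector_derivative)
qed (use assms in simp)

lemma inverse_radius: "1 / radius t = cube t powr (-2/3)"
  by (simp add: radius_def powr_minus_divide)

lemma inverse_radius_has_integral: "((\<lambda>t. 1 / radius t) has_integral D) {A..A + duration}"
proof (cases "\<alpha> = \<beta>")
  case True
  then have "cube t = \<alpha> ^ 3" for t
    unfolding cube_def by simp
  then have "radius t = \<alpha>\<^sup>2" for t
    unfolding radius_def using \<alpha>_nonneg by (simp add: cube_powr)
  moreover have "duration = D * \<alpha>\<^sup>2"
    unfolding duration_def using True by (simp add: power2_eq_square)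
  ultimately show ?thesis
    using has_integral_const_real[of "1 / \<alpha>\<^sup>2" A "A + duration"] True \<beta>_pos duration_pos by simp
next
  case False
  define g where "g = (\<lambda>t. D / (\<beta> - \<alpha>) * cube t powr (1/3))"
  have "((\<lambda>t. 1 / radius t) has_integral g (A + duration) - g A) {A..A + duration}"
  proof (rule fundamental_theorem_of_calculus_interior)
    show "continuous_on {A..A + duration} g"
      unfolding g_def by (intro continuous_intros continuous_on_cube_powr) simp
    fix t assume "t \<in> {A<..<A + duration}"
    then have "(g has_real_derivative
        D / (\<beta> - \<alpha>) * (1/3 * cube t powr (1/3 - 1) * (3 * (\<beta> - \<alpha>) / D))) (at t)"
      unfolding g_def by (intro DERIV_cmult has_derivative_cube_powr) auto
    also have "D / (\<beta> - \<alpha>) * (1/3 * x * (3 * (\<beta> - \<alpha>) / D)) = x" for x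
      using False D_pos by (simp add: divide_simps)
    finally show "(g has_vector_derivative 1 / radius t) (at t)"
      by (simp add: inverse_radius has_real_derivative_iff_has_vector_derivative)
  qed (use duration_pos in simp)
  moreover have "g (A + duration) - g A = D / (\<beta> - \<alpha>) * (\<beta> - \<alpha>)"
    using \<alpha>_nonneg \<beta>_pos by (simp add: g_def cube_start cube_end cube_powr right_diff_distrib)
  ultimately show ?thesis using False by simp
qed

lemma speed_power2_has_integral:
  "((\<lambda>t. (speed t)\<^sup>2) has_integral 4 * (\<beta> - \<alpha>)\<^sup>2 / D) {A..A + duration}"
proof -
  have "(speed t)\<^sup>2 = (2 * (\<beta> - \<alpha>) / D)\<^sup>2 * (1 / radius t)" for t
  proof -
    have "(cube t powr (-1/3))\<^sup>2 = cube t powr (-2/3)"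
      by (simp add: power2_eq_square powr_add[symmetric])
    then show ?thesis
      by (simp only: speed_def inverse_radius power_mult_distrib)
  qed
  moreover have "(2 * (\<beta> - \<alpha>) / D)\<^sup>2 * D = 4 * (\<beta> - \<alpha>)\<^sup>2 / D"
    using D_pos by (simp add: power2_eq_square field_simps)
  ultimately show ?thesis
    using has_integral_mult_right[OF inverse_radius_has_integral, of "(2 * (\<beta> - \<alpha>) / D)\<^sup>2"]
    by (simp only:)
qed

lemma radial_path: "radial_path A (A + duration) radius speed"
  unfolding radial_path_def finite_potential_def
proof (intro conjI ballI radius_nonneg)
  have [measurable]: "cube \<in> borel_measurable borel"
    unfolding cube_def[abs_def] by measurable
  have "speed \<in> borel_measurable borel"
    unfolding speed_def[abs_def] by measurable
  then show "L2_deriv A (A + duration) radius speed"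
    using speed_power2_has_integral by (intro L2_derivI_borel speed_has_integral) auto
  have "radius \<in> borel_measurable borel"
    unfolding radius_def[abs_def] by measurable
  then show "set_integrable lborel {A..A + duration} (\<lambda>t. 1 / norm (radius t))"
    using inverse_radius_has_integral radius_nonneg
    by (intro set_integrable_if_nonneg_integrable_on) (auto simp: set_borel_measurable_def)
  have "AE t in lborel. t \<noteq> A"
    by (rule AE_lborel_singleton)
  then show "AE t in lborel. t \<in> {A..A + duration} \<longrightarrow> radius t \<noteq> 0"
    by eventually_elim (use cube_pos in \<open>force simp: radius_def\<close>)
qed

lemma integral_radius_ge: "D * min \<alpha> \<beta> ^ 4 \<le> integral {A..A + duration} radius"
proof -
  let ?m = "min \<alpha> \<beta>"
  have m: "?m \<ge> 0" using \<alpha>_nonneg \<beta>_pos by simp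
  then have "?m\<^sup>2 \<le> \<alpha>\<^sup>2" "?m * ?m \<le> \<alpha> * \<beta>" "?m\<^sup>2 \<le> \<beta>\<^sup>2"
    by (auto intro!: power_mono mult_mono)
  then have "D * (3 * ?m\<^sup>2) \<le> D * (\<alpha>\<^sup>2 + \<alpha> * \<beta> + \<beta>\<^sup>2)"
    using D_pos by (intro mult_left_mono) (auto simp: power2_eq_square)
  then have "D * ?m\<^sup>2 * ?m\<^sup>2 \<le> duration * ?m\<^sup>2"
    by (intro mult_right_mono) (auto simp: duration_def)
  also have "\<dots> = integral {A..A + duration} (\<lambda>t. ?m\<^sup>2)"
    using duration_pos by simp
  also have "\<dots> \<le> integral {A..A + duration} radius"
    by (intro integral_le radius_ge radial_path_integrable(3)[OF radial_path]) auto
  finally show ?thesis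
    by (simp add: power4_eq_xxxx power2_eq_square mult.assoc)
qed

lemma radial_action_le:
  "radial_action A (A + duration) radius speed \<le> 2 * (\<beta> - \<alpha>)\<^sup>2 / D + D - D * min \<alpha> \<beta> ^ 4"
proof -
  have "integral {A..A + duration} (\<lambda>t. (speed t)\<^sup>2 / 2) = 2 * (\<beta> - \<alpha>)\<^sup>2 / D"
    using integral_unique[OF has_integral_divide[OF speed_power2_has_integral, of 2]] by simp
  then show ?thesis
    unfolding radial_action_def
    using integral_radius_ge integral_unique[OF inverse_radius_has_integral] by simp
qed

lemma radial_path_extends:
  assumes r: "radial_path a A r v" and A: "a \<le> A" "r A = \<alpha>\<^sup>2"
  shows "\<exists>R V. radial_path a (A + duration) R V \<and> R a = r a \<and> R (A + duration) = \<beta>\<^sup>2 \<and>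
    radial_action a (A + duration) R V
      \<le> radial_action a A r v + (2 * (\<beta> - \<alpha>)\<^sup>2 / D + D - D * min \<alpha> \<beta> ^ 4)"
proof -
  define R where "R = (\<lambda>t. if t \<le> A then r t else radius t)"
  define V where "V = (\<lambda>t. if t \<le> A then v t else speed t)"
  have ends: "A \<le> A + duration" "r A = radius A"
    using duration_pos A(2) radius_start by auto
  have "radial_path a (A + duration) R V"
    "radial_action a (A + duration) R V = radial_action a A r v + radial_action A (A + duration) radius speed"
    unfolding R_def V_def by (rule radial_path_glue[OF r radial_path A(1) ends])+
  moreover have "R a = r a" "R (A + duration) = \<beta>\<^sup>2"
    using A(1) duration_pos radius_end by (auto simp: R_def)
  ultimately show ?thesis
    using radial_action_le by (intro exI[of _ R] exI[of _ V]) simp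
qed

end

definition polygon_duration :: "real \<Rightarrow> (nat \<Rightarrow> real) \<Rightarrow> nat \<Rightarrow> real" where
  "polygon_duration D h n = (\<Sum>i<n. D * ((h i)\<^sup>2 + h i * h (Suc i) + (h (Suc i))\<^sup>2) / 3)"

lemma polygon_duration_scale: "polygon_duration D (\<lambda>i. k * h i) n = k\<^sup>2 * polygon_duration D h n"
  unfolding polygon_duration_def sum_distrib_left
  by (rule sum.cong) (auto simp: power2_eq_square algebra_simps)

lemma polygon_duration_pos:
  assumes "D > 0" "n > 0" and start: "h 0 = 0" and h: "\<And>i. \<lbrakk>0 < i; i \<le> n\<rbrakk> \<Longrightarrow> h i > 0"
  shows "polygon_duration D h n > 0"
  unfolding polygon_duration_def
proof (rule sum_pos)
  fix i assume "i \<in> {..<n}"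
  then have "h i \<ge> 0" "h (Suc i) > 0"
    using start h[of i] h[of "Suc i"] by (cases "i = 0"; simp)+
  then show "0 < D * ((h i)\<^sup>2 + h i * h (Suc i) + (h (Suc i))\<^sup>2) / 3"
    using \<open>D > 0\<close> by (simp add: add_nonneg_pos)
qed (use \<open>n > 0\<close> in auto)

definition polygon_action_bound :: "real \<Rightarrow> (nat \<Rightarrow> real) \<Rightarrow> nat \<Rightarrow> real" where
  "polygon_action_bound D h n =
     2 * (\<Sum>i<n. (h (Suc i) - h i)\<^sup>2) / D + n * D - D * (\<Sum>i<n. min (h i) (h (Suc i)) ^ 4)"

lemma radial_polygon_exists:
  assumes D: "D > 0" and start: "h 0 = 0" and h: "\<And>i. \<lbrakk>0 < i; i \<le> n\<rbrakk> \<Longrightarrow> h i > 0"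
  shows "\<exists>r v. radial_path 0 (polygon_duration D h n) r v \<and>
    r 0 = 0 \<and> r (polygon_duration D h n) = (h n)\<^sup>2 \<and>
    radial_action 0 (polygon_duration D h n) r v \<le> polygon_action_bound D h n"
  using h
proof (induction n)
  case 0
  have "AE t::real in lborel. t \<noteq> 0"
    by (rule AE_lborel_singleton)
  then have "finite_potential {0..0} (\<lambda>t::real. 0::real)"
    unfolding finite_potential_def by (auto simp: set_integrable_def)
  then have "radial_path 0 0 (\<lambda>t. 0) (\<lambda>t. 0)"
    by (simp add: radial_path_def L2_deriv_const)
  then show ?case
    by (intro exI[of _ "\<lambda>t. 0"])
      (simp add: polygon_duration_def polygon_action_bound_def radial_action_def start)
next
  case (Suc n)
  define A where "A = polygon_duration D h n"
  obtain r v where r: "radial_path 0 A r v" "r 0 = 0" "r A = (h n)\<^sup>2"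
    "radial_action 0 A r v \<le> polygon_action_bound D h n"
    using Suc unfolding A_def by force
  have A: "0 \<le> A"
    using polygon_duration_pos[of D n h] Suc.prems D start
    by (cases "n = 0") (auto simp: A_def polygon_duration_def)
  have "h n \<ge> 0"
    using Suc.prems[of n] start by (cases "n = 0") auto
  then interpret arc: kepler_arc "h n" "h (Suc n)" D A
    using Suc.prems[of "Suc n"] D by unfold_locales auto
  have "polygon_duration D h (Suc n) = A + arc.duration"
    by (simp add: A_def polygon_duration_def arc.duration_def)
  moreover have "polygon_action_bound D h (Suc n) = polygon_action_bound D h n
      + (2 * (h (Suc n) - h n)\<^sup>2 / D + D - D * min (h n) (h (Suc n)) ^ 4)"
    by (simp add: polygon_action_bound_def algebra_simps add_divide_distrib)
  ultimately show ?case
    using arc.radial_path_extends[OF r(1) A r(3)] r(2,4) by force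
qed

lemma radial_polygon_rescaled:
  assumes D: "D > 0" and T: "T > 0" and n: "n > 0"
    and start: "h 0 = 0" and h: "\<And>i. \<lbrakk>0 < i; i \<le> n\<rbrakk> \<Longrightarrow> h i > 0"
  defines "c \<equiv> T / polygon_duration D h n"
  shows "\<exists>r v. radial_path 0 T r v \<and> r 0 = 0 \<and> radial_action 0 T r v \<le>
      c * (2 * (\<Sum>i<n. (h (Suc i) - h i)\<^sup>2) / D) + n * D - c\<^sup>2 * (D * (\<Sum>i<n. min (h i) (h (Suc i)) ^ 4))"
proof -
  have \<theta>: "polygon_duration D h n > 0"
    using D n start h by (rule polygon_duration_pos)
  then have c: "c > 0" using T by (simp add: c_def)
  define k where "k = sqrt c"
  have k: "k > 0" "k\<^sup>2 = c" "k ^ 4 = c\<^sup>2"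
    using c by (simp_all add: k_def power4_eq_xxxx power2_eq_square)
  have "polygon_duration D (\<lambda>i. k * h i) n = T"
    using \<theta> by (simp add: polygon_duration_scale k c_def)
  moreover have "(k * h (Suc i) - k * h i)\<^sup>2 = c * (h (Suc i) - h i)\<^sup>2" for i
    by (simp add: right_diff_distrib[symmetric] power_mult_distrib k)
  moreover have "min (k * h i) (k * h (Suc i)) ^ 4 = c\<^sup>2 * min (h i) (h (Suc i)) ^ 4" for i
  proof -
    have "min (k * h i) (k * h (Suc i)) = k * min (h i) (h (Suc i))"
      using k(1) by (simp add: min_mult_distrib_left)
    then show ?thesis by (simp add: power_mult_distrib k(3))
  qed
  ultimately show ?thesis
    using radial_polygon_exists[of D "\<lambda>i. k * h i" n] D start h k(1)
    by (auto simp: polygon_action_bound_def sum_distrib_left[symmetric] algebra_simps)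
qed

section \<open>Competitors from profiles in Levi-Civita time\<close>

definition grid :: "real \<Rightarrow> nat \<Rightarrow> nat \<Rightarrow> real" where
  "grid S N i = S * real i / real N"

abbreviation grid_cell :: "real \<Rightarrow> nat \<Rightarrow> nat \<Rightarrow> real set" where
  "grid_cell S N i \<equiv> {grid S N i..grid S N (Suc i)}"

lemma grid_ends: "grid S N 0 = 0" "N > 0 \<Longrightarrow> grid S N N = S"
  by (simp_all add: grid_def)

lemma grid_step: "grid S N (Suc i) - grid S N i = S / N"
  by (simp add: grid_def distrib_left add_divide_distrib)

lemma grid_mono: "S \<ge> 0 \<Longrightarrow> grid S N i \<le> grid S N (Suc i)"
  by (simp add: grid_def divide_right_mono mult_left_mono)

lemma grid_mem: "\<lbrakk>S \<ge> 0; i \<le> N\<rbrakk> \<Longrightarrow> grid S N i \<in> {0..S}"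
  by (cases "N = 0") (auto simp: grid_def field_simps mult_left_mono)

lemma grid_cell_subset: "\<lbrakk>S \<ge> 0; i < N\<rbrakk> \<Longrightarrow> grid_cell S N i \<subseteq> {0..S}"
  using grid_mem[of S i N] grid_mem[of S "Suc i" N] by auto

lemma grid_reflect: "\<lbrakk>i \<le> N; N > 0\<rbrakk> \<Longrightarrow> S - grid S N i = grid S N (N - i)"
  by (auto simp: grid_def of_nat_diff field_simps)

lemma Riemann_sum_error_le:
  fixes f :: "real \<Rightarrow> real" and F :: "nat \<Rightarrow> real"
  assumes f: "continuous_on {0..S} f" and S: "S \<ge> 0" and N: "N > 0"
    and F: "\<And>i t. \<lbrakk>i < N; t \<in> grid_cell S N i\<rbrakk> \<Longrightarrow> \<bar>F i - f t\<bar> \<le> e"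
  shows "\<bar>S / N * (\<Sum>i<N. F i) - integral {0..S} f\<bar> \<le> e * S"
proof -
  have f_int: "f integrable_on grid_cell S N i" if "i < N" for i
    using f grid_cell_subset[OF S that] by (intro integrable_continuous_real) (rule continuous_on_subset)
  have const: "((\<lambda>t. c) has_integral S / N * c) (grid_cell S N i)" for c i
    using has_integral_const_real[of c "grid S N i" "grid S N (Suc i)"] grid_mono[OF S, of N i]
    by (simp add: grid_step)
  have "integral {0..S} f = (\<Sum>i<N. integral (grid_cell S N i) f)"
    using sum_integral_adjacent[of N "grid S N" f] grid_mono[OF S] integrable_continuous_real[OF f] N
    by (simp add: grid_ends)
  then have "S / N * (\<Sum>i<N. F i) - integral {0..S} f = (\<Sum>i<N. S / N * F i - integral (grid_cell S N i) f)"
    by (simp add: sum_distrib_left sum_subtractf)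
  also have "\<bar>\<dots>\<bar> \<le> (\<Sum>i<N. S / N * e)"
  proof (rule order_trans[OF sum_abs sum_mono])
    fix i assume "i \<in> {..<N}"
    then have i: "i < N" by simp
    have diff: "((\<lambda>t. F i - f t) has_integral S / N * F i - integral (grid_cell S N i) f) (grid_cell S N i)"
      by (intro has_integral_diff const integrable_integral f_int i)
    have "norm (S / N * F i - integral (grid_cell S N i) f) \<le> S / N * e"
      unfolding integral_unique[OF diff, symmetric] integral_unique[OF const[of e i], symmetric]
      using F[OF i] diff const[of e i]
      by (intro integral_norm_bound_integral) auto
    then show "\<bar>S / N * F i - integral (grid_cell S N i) f\<bar> \<le> S / N * e" by simp
  qed
  also have "\<dots> = e * S" using N by simp
  finally show ?thesis .
qed

lemma Riemann_sum_tendsto: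
  fixes f :: "real \<Rightarrow> real" and F :: "nat \<Rightarrow> nat \<Rightarrow> real"
  assumes f: "continuous_on {0..S} f" and S: "S > 0"
    and F: "\<And>N i. i < N \<Longrightarrow> \<exists>x\<in>grid_cell S N i. \<exists>y\<in>grid_cell S N i.
      f x \<le> F N i \<and> F N i \<le> f y"
  shows "(\<lambda>N. S / N * (\<Sum>i<N. F N i)) \<longlonglongrightarrow> integral {0..S} f"
proof (rule LIMSEQ_I)
  fix e :: real assume e: "e > 0"
  have "uniformly_continuous_on {0..S} f"
    by (intro compact_uniformly_continuous f compact_Icc)
  then obtain d where d: "d > 0"
    "\<And>x t. \<lbrakk>x \<in> {0..S}; t \<in> {0..S}; \<bar>x - t\<bar> < d\<rbrakk> \<Longrightarrow> \<bar>f x - f t\<bar> < e / (2 * S)"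
    using e S unfolding uniformly_continuous_on_def dist_real_def
    by (metis divide_pos_pos mult_pos_pos zero_less_numeral)
  obtain M :: nat where M: "S / d < M"
    using reals_Archimedean2 by blast
  have "norm (S / N * (\<Sum>i<N. F N i) - integral {0..S} f) < e" if "N \<ge> M" for N
  proof -
    have "S / d < N" using M that by linarith
    moreover have "S / d > 0" using S d by simp
    ultimately have N: "N > 0"
      by (auto intro!: gr0I)
    have "S / N < d"
      using \<open>S / d < N\<close> N d(1) by (simp add: pos_divide_less_eq mult.commute)
    have "\<bar>S / N * (\<Sum>i<N. F N i) - integral {0..S} f\<bar> \<le> e / (2 * S) * S"
    proof (rule Riemann_sum_error_le[OF f _ N])
      fix i t assume i: "i < N" and t: "t \<in> grid_cell S N i"
      have "\<bar>f x - f t\<bar> < e / (2 * S)" if "x \<in> grid_cell S N i" for x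
        using that t grid_cell_subset[of S i N] i S grid_step[of S N i] \<open>S / N < d\<close> by (intro d(2)) auto
      moreover obtain x y where "x \<in> grid_cell S N i" "y \<in> grid_cell S N i"
        "f x \<le> F N i" "F N i \<le> f y"
        using F[OF i] by blast
      ultimately show "\<bar>F N i - f t\<bar> \<le> e / (2 * S)"
        by (fastforce simp: abs_le_iff abs_less_iff)
    qed (use S in simp)
    also have "\<dots> < e" using e S by simp
    finally show ?thesis by simp
  qed
  then show "\<exists>M. \<forall>N\<ge>M. norm (S / N * (\<Sum>i<N. F N i) - integral {0..S} f) < e" by blast
qed

definition discrete_energy :: "real \<Rightarrow> nat \<Rightarrow> (real \<Rightarrow> 'a::real_normed_vector) \<Rightarrow> real" where
  "discrete_energy S N z = (\<Sum>i<N. (norm (z (grid S N (Suc i)) - z (grid S N i)))\<^sup>2) / (S / N)"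

lemma discrete_energy_norm_le:
  assumes "S \<ge> 0"
  shows "discrete_energy S N (\<lambda>s. norm (z s)) \<le> discrete_energy S N z"
  unfolding discrete_energy_def using assms norm_triangle_ineq3
  by (intro divide_right_mono sum_mono power_mono) auto

lemma discrete_energy_Pair:
  "discrete_energy S N (\<lambda>s. (f s, g s)) = discrete_energy S N f + discrete_energy S N g"
  unfolding discrete_energy_def add_divide_distrib[symmetric] sum.distrib[symmetric]
  by (simp add: norm_prod_def)

lemma discrete_energy_reflect: "discrete_energy S N (\<lambda>s. z (S - s)) = discrete_energy S N z"
proof -
  have "(\<Sum>i<N. (norm (z (S - grid S N (Suc i)) - z (S - grid S N i)))\<^sup>2)
      = (\<Sum>i<N. (norm (z (grid S N (Suc (N - Suc i))) - z (grid S N (N - Suc i))))\<^sup>2)"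
    by (intro sum.cong) (auto simp: grid_reflect Suc_diff_Suc norm_minus_commute)
  then show ?thesis
    using sum.nat_diff_reindex[of "\<lambda>j. (norm (z (grid S N (Suc j)) - z (grid S N j)))\<^sup>2" N]
    by (simp add: discrete_energy_def)
qed

lemma discrete_energy_linear:
  assumes "S > 0" "N > 0"
  shows "discrete_energy S N (\<lambda>s. k * s) = k\<^sup>2 * S"
  unfolding discrete_energy_def right_diff_distrib[symmetric] grid_step using assms
  by (simp add: power_mult_distrib power2_eq_square power_divide)

lemma mean_square_between:
  fixes x y :: real
  assumes "x \<ge> 0" "y \<ge> 0"
  shows "min (x\<^sup>2) (y\<^sup>2) \<le> (x\<^sup>2 + x * y + y\<^sup>2) / 3" "(x\<^sup>2 + x * y + y\<^sup>2) / 3 \<le> max (x\<^sup>2) (y\<^sup>2)"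
proof -
  have "min (x\<^sup>2) (y\<^sup>2) \<le> x * y \<and> x * y \<le> max (x\<^sup>2) (y\<^sup>2)"
  proof (cases "x \<le> y")
    case True
    then show ?thesis
      using mult_left_mono[OF True assms(1)] mult_right_mono[OF True assms(2)]
      by (simp add: power2_eq_square min_le_iff_disj le_max_iff_disj)
  next
    case False
    then have "y \<le> x" by simp
    then show ?thesis
      using mult_left_mono[OF \<open>y \<le> x\<close> assms(1)] mult_right_mono[OF \<open>y \<le> x\<close> assms(2)]
      by (simp add: power2_eq_square min_le_iff_disj le_max_iff_disj)
  qed
  then show "min (x\<^sup>2) (y\<^sup>2) \<le> (x\<^sup>2 + x * y + y\<^sup>2) / 3" "(x\<^sup>2 + x * y + y\<^sup>2) / 3 \<le> max (x\<^sup>2) (y\<^sup>2)"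
    by (auto simp: min_def max_def split: if_splits)
qed

lemma polygon_duration_tendsto:
  assumes H: "continuous_on {0..S} H" and S: "S > 0" and nonneg: "\<And>s. s \<in> {0..S} \<Longrightarrow> 0 \<le> H s"
  shows "(\<lambda>N. polygon_duration (S / N) (\<lambda>i. H (grid S N i)) N) \<longlonglongrightarrow> integral {0..S} (\<lambda>s. (H s)\<^sup>2)"
proof -
  let ?h = "\<lambda>N i. H (grid S N i)"
  have "(\<lambda>N. S / N * (\<Sum>i<N. ((?h N i)\<^sup>2 + ?h N i * ?h N (Suc i) + (?h N (Suc i))\<^sup>2) / 3))
      \<longlonglongrightarrow> integral {0..S} (\<lambda>s. (H s)\<^sup>2)"
  proof (rule Riemann_sum_tendsto[OF _ S])
    show "continuous_on {0..S} (\<lambda>s. (H s)\<^sup>2)" by (intro continuous_intros H)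
    fix N i :: nat assume i: "i < N"
    have ends: "grid S N i \<in> grid_cell S N i"
        "grid S N (Suc i) \<in> grid_cell S N i"
      using grid_mono[of S N i] S by auto
    have "?h N i \<ge> 0" "?h N (Suc i) \<ge> 0"
      using i S by (auto intro!: nonneg grid_mem)
    from mean_square_between[OF this]
    show "\<exists>x\<in>grid_cell S N i. \<exists>y\<in>grid_cell S N i.
        (H x)\<^sup>2 \<le> ((?h N i)\<^sup>2 + ?h N i * ?h N (Suc i) + (?h N (Suc i))\<^sup>2) / 3 \<and>
        ((?h N i)\<^sup>2 + ?h N i * ?h N (Suc i) + (?h N (Suc i))\<^sup>2) / 3 \<le> (H y)\<^sup>2"
      using ends unfolding min_le_iff_disj le_max_iff_disj by blast
  qed
  then show ?thesis
    by (simp add: polygon_duration_def sum_distrib_left)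
qed

lemma polygon_min_power4_tendsto:
  assumes H: "continuous_on {0..S} H" and S: "S > 0"
  shows "(\<lambda>N. S / N * (\<Sum>i<N. min (H (grid S N i)) (H (grid S N (Suc i))) ^ 4))
    \<longlonglongrightarrow> integral {0..S} (\<lambda>s. H s ^ 4)"
proof (rule Riemann_sum_tendsto[OF _ S])
  show "continuous_on {0..S} (\<lambda>s. H s ^ 4)" by (intro continuous_intros H)
  fix N i :: nat
  have "grid S N i \<in> grid_cell S N i" "grid S N (Suc i) \<in> grid_cell S N i"
    using grid_mono[of S N i] S by auto
  then show "\<exists>x\<in>grid_cell S N i. \<exists>y\<in>grid_cell S N i.
      H x ^ 4 \<le> min (H (grid S N i)) (H (grid S N (Suc i))) ^ 4 \<and>
      min (H (grid S N i)) (H (grid S N (Suc i))) ^ 4 \<le> H y ^ 4"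
    by (auto simp: min_def)
qed

text \<open>A path on the axis whose distance is the square of \<open>H\<close> in Levi-Civita time has action at most
  \<open>2 K + S - \<integral> H\<^sup>4\<close>; the factor \<open>c\<close> adjusts its duration \<open>\<integral> H\<^sup>2\<close> to \<open>T\<close>.\<close>

lemma radial_infimum_le_positive_profile:
  assumes S: "S > 0" and T: "T > 0"
    and H: "continuous_on {0..S} H" "H 0 = 0" "\<And>s. s \<in> {0<..S} \<Longrightarrow> H s > 0"
    and K: "\<And>N. N > 0 \<Longrightarrow> discrete_energy S N H \<le> K"
    and m: "radial_lower_bound T m"
  defines "c \<equiv> T / integral {0..S} (\<lambda>s. (H s)\<^sup>2)"
  shows "m \<le> c * (2 * K) + S - c\<^sup>2 * integral {0..S} (\<lambda>s. H s ^ 4)"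
proof -
  define \<theta> where "\<theta> = (\<lambda>N. polygon_duration (S / N) (\<lambda>i. H (grid S N i)) N)"
  define Q where "Q = (\<lambda>N. S / N * (\<Sum>i<N. min (H (grid S N i)) (H (grid S N (Suc i))) ^ 4))"
  have nonneg: "0 \<le> H s" if "s \<in> {0..S}" for s
    using H(2) H(3)[of s] that by (cases "s = 0") auto
  have bound: "m \<le> T / \<theta> N * (2 * K) + S - (T / \<theta> N)\<^sup>2 * Q N" if "N \<ge> 1" for N
  proof -
    have N: "N > 0" using that by simp
    then have D: "S / N > 0" using S by simp
    have h: "H (grid S N 0) = 0" "\<And>i. \<lbrakk>0 < i; i \<le> N\<rbrakk> \<Longrightarrow> H (grid S N i) > 0"
      using H(2) grid_mem[of S _ N] S N by (auto simp: grid_ends intro!: H(3)) (simp add: grid_def)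
    obtain r w where r: "radial_path 0 T r w" "r 0 = 0"
      and r_action: "radial_action 0 T r w \<le>
        T / \<theta> N * (2 * (\<Sum>i<N. (H (grid S N (Suc i)) - H (grid S N i))\<^sup>2) / (S / N))
        + N * (S / N) - (T / \<theta> N)\<^sup>2 * Q N"
      using radial_polygon_rescaled[of "S / N" T N "\<lambda>i. H (grid S N i)", OF D T N h]
      unfolding \<theta>_def Q_def by blast
    have "2 * (\<Sum>i<N. (H (grid S N (Suc i)) - H (grid S N i))\<^sup>2) / (S / N) = 2 * discrete_energy S N H"
      by (simp add: discrete_energy_def)
    moreover have "T / \<theta> N \<ge> 0"
      using polygon_duration_pos[of "S / N" N "\<lambda>i. H (grid S N i)"] D N h T by (simp add: \<theta>_def)
    then have "T / \<theta> N * (2 * discrete_energy S N H) \<le> T / \<theta> N * (2 * K)"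
      using K[OF N] by (intro mult_left_mono) auto
    ultimately show ?thesis
      using radial_lower_boundD[OF m r] r_action N by simp
  qed
  have "integral {0..S} (\<lambda>s. (H s)\<^sup>2) \<noteq> 0"
    using S H(1) H(3)[of S] by (subst integral_eq_0_iff) (auto intro!: continuous_intros bexI[of _ S])
  then have "(\<lambda>N. T / \<theta> N * (2 * K) + S - (T / \<theta> N)\<^sup>2 * Q N)
      \<longlonglongrightarrow> c * (2 * K) + S - c\<^sup>2 * integral {0..S} (\<lambda>s. H s ^ 4)"
    unfolding c_def \<theta>_def Q_def using nonneg S H(1)
    by (intro tendsto_intros polygon_duration_tendsto polygon_min_power4_tendsto) auto
  then show ?thesis
    by (rule LIMSEQ_le_const) (use bound in blast)
qed

text \<open>Adding \<open>e s\<close> in quadrature makes a profile positive away from the initial collision.\<close>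

lemma radial_infimum_le_tilted_profile:
  assumes S: "S > 0" and T: "T > 0" and e: "e > 0"
    and H: "continuous_on {0..S} H" "H 0 = 0" and time: "integral {0..S} (\<lambda>s. (H s)\<^sup>2) = T"
    and K: "\<And>N. N > 0 \<Longrightarrow> discrete_energy S N H \<le> K"
    and m: "radial_lower_bound T m"
  defines "c \<equiv> T / (T + e\<^sup>2 * S ^ 3 / 3)"
  shows "m \<le> c * (2 * (K + e\<^sup>2 * S)) + S - c\<^sup>2 * integral {0..S} (\<lambda>s. H s ^ 4)"
proof -
  define G where "G s = norm (H s, e * s)" for s
  have G_cont: "continuous_on {0..S} G"
    unfolding G_def[abs_def] by (intro continuous_intros H)
  have G_power2: "(G s)\<^sup>2 = (H s)\<^sup>2 + e\<^sup>2 * s\<^sup>2" for s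
    by (simp add: G_def norm_prod_def power_mult_distrib)
  have G_start: "G 0 = 0"
    using H(2) by (simp add: G_def)
  have G_pos: "G s > 0" if "s \<in> {0<..S}" for s
    using e that by (simp add: G_def zero_prod_def)
  have "integral {0..S} (\<lambda>s. (G s)\<^sup>2) = integral {0..S} (\<lambda>s. (H s)\<^sup>2) + integral {0..S} (\<lambda>s. e\<^sup>2 * s\<^sup>2)"
    unfolding G_power2 by (intro integral_add integrable_continuous_real continuous_intros H)
  also have "\<dots> = T + e\<^sup>2 * S ^ 3 / 3"
    using S time by (simp add: integral_power2)
  finally have G_time: "integral {0..S} (\<lambda>s. (G s)\<^sup>2) = T + e\<^sup>2 * S ^ 3 / 3" .
  have G_energy: "discrete_energy S N G \<le> K + e\<^sup>2 * S" if "N > 0" for N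
  proof -
    have "discrete_energy S N G \<le> discrete_energy S N (\<lambda>s. (H s, e * s))"
      unfolding G_def[abs_def] using S by (intro discrete_energy_norm_le) simp
    then show ?thesis
      using K[OF that] S that by (simp add: discrete_energy_Pair discrete_energy_linear)
  qed
  have "H s ^ 4 \<le> G s ^ 4" for s
  proof -
    have "(H s)\<^sup>2 \<le> (G s)\<^sup>2" by (simp add: G_power2)
    from power_mono[OF this, of 2] show ?thesis by simp
  qed
  then have "integral {0..S} (\<lambda>s. H s ^ 4) \<le> integral {0..S} (\<lambda>s. G s ^ 4)"
    by (intro integral_le integrable_continuous_real continuous_intros H G_cont)
  then have "c\<^sup>2 * integral {0..S} (\<lambda>s. H s ^ 4) \<le> c\<^sup>2 * integral {0..S} (\<lambda>s. G s ^ 4)"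
    by (intro mult_left_mono) auto
  moreover have "m \<le> c * (2 * (K + e\<^sup>2 * S)) + S - c\<^sup>2 * integral {0..S} (\<lambda>s. G s ^ 4)"
    unfolding c_def G_time[symmetric]
    by (rule radial_infimum_le_positive_profile[OF S T G_cont G_start G_pos G_energy m])
  ultimately show ?thesis by linarith
qed

lemma radial_infimum_le_profile:
  assumes S: "S > 0" and T: "T > 0"
    and H: "continuous_on {0..S} H" "H 0 = 0" and time: "integral {0..S} (\<lambda>s. (H s)\<^sup>2) = T"
    and K: "\<And>N. N > 0 \<Longrightarrow> discrete_energy S N H \<le> K"
    and m: "radial_lower_bound T m"
  shows "m \<le> 2 * K + S - integral {0..S} (\<lambda>s. H s ^ 4)"
proof -
  define c where "c e = T / (T + e\<^sup>2 * S ^ 3 / 3)" for e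
  define f where "f e = c e * (2 * (K + e\<^sup>2 * S)) + S - (c e)\<^sup>2 * integral {0..S} (\<lambda>s. H s ^ 4)" for e
  have "isCont f 0"
    unfolding f_def[abs_def] c_def using T by (intro continuous_intros) auto
  then have "(f \<longlongrightarrow> f 0) (at_right 0)"
    unfolding isCont_def by (rule tendsto_within_subset) simp
  moreover have "m \<le> f e" if "e > 0" for e
    unfolding f_def c_def by (rule radial_infimum_le_tilted_profile[OF S T that H time K m])
  then have "\<forall>\<^sub>F e in at_right 0. m \<le> f e"
    by (rule eventually_mono[OF eventually_at_right_less])
  ultimately have "m \<le> f 0"
    by (rule tendsto_lowerbound) simp
  then show ?thesis
    using T by (simp add: f_def c_def)
qed

section \<open>Parabolic coordinates\<close>

definition parabolic :: "real \<times> real \<Rightarrow> real \<times> real" where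
  "parabolic p = (sqrt ((norm p + fst p) / 2), sqrt ((norm p - fst p) / 2))"

lemma abs_fst_le_norm: "\<bar>fst p\<bar> \<le> norm (p :: real \<times> real)"
  using norm_fst_le[of "fst p" "snd p"] by simp

lemma parabolic_nonneg: "fst (parabolic p) \<ge> 0" "snd (parabolic p) \<ge> 0"
  using abs_fst_le_norm[of p] by (auto simp: parabolic_def)

lemma parabolic_squares:
  "(fst (parabolic p))\<^sup>2 = (norm p + fst p) / 2" "(snd (parabolic p))\<^sup>2 = (norm p - fst p) / 2"
  using abs_fst_le_norm[of p] by (auto simp: parabolic_def)

lemma norm_parabolic: "norm (parabolic p) = sqrt (norm p)"
proof -
  have "norm (parabolic p) = sqrt ((fst (parabolic p))\<^sup>2 + (snd (parabolic p))\<^sup>2)"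
    by (simp add: norm_prod_def)
  then show ?thesis by (simp add: parabolic_squares field_simps)
qed

lemma parabolic_fst: "(fst (parabolic p))\<^sup>2 - (snd (parabolic p))\<^sup>2 = fst p"
  by (simp add: parabolic_squares field_simps)

lemma parabolic_abs_snd: "2 * fst (parabolic p) * snd (parabolic p) = \<bar>snd p\<bar>"
proof (rule power2_eq_imp_eq)
  have "(2 * fst (parabolic p) * snd (parabolic p))\<^sup>2
      = 4 * (fst (parabolic p))\<^sup>2 * (snd (parabolic p))\<^sup>2"
    by (simp add: power_mult_distrib)
  also have "\<dots> = (norm p)\<^sup>2 - (fst p)\<^sup>2"
    unfolding parabolic_squares by (simp add: power2_eq_square field_simps)
  also have "\<dots> = \<bar>snd p\<bar>\<^sup>2"
    by (simp add: norm_prod_def)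
  finally show "(2 * fst (parabolic p) * snd (parabolic p))\<^sup>2 = \<bar>snd p\<bar>\<^sup>2" .
qed (simp_all add: parabolic_nonneg)

lemma continuous_on_parabolic: "continuous_on S q \<Longrightarrow> continuous_on S (\<lambda>t. parabolic (q t))"
  unfolding parabolic_def by (intro continuous_intros) auto

text \<open>In complex notation this is \<open>\<bar>z - w\<bar> \<bar>z + w\<bar> = \<bar>z\<^sup>2 - w\<^sup>2\<bar>\<close>, with \<open>z\<^sup>2 = fst p + i \<bar>snd p\<bar>\<close>.\<close>

lemma norm_parabolic_diff_mult_sum_le:
  "norm (parabolic p - parabolic q) * norm (parabolic p + parabolic q) \<le> norm (p - q)"
proof (rule power2_le_imp_le)
  obtain a b where p: "parabolic p = (a, b)" by (cases "parabolic p")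
  obtain c d where q: "parabolic q = (c, d)" by (cases "parabolic q")
  have "(norm (parabolic p - parabolic q) * norm (parabolic p + parabolic q))\<^sup>2
      = ((a - c)\<^sup>2 + (b - d)\<^sup>2) * ((a + c)\<^sup>2 + (b + d)\<^sup>2)"
    by (simp add: p q norm_prod_def power_mult_distrib)
  also have "\<dots> = ((a\<^sup>2 - b\<^sup>2) - (c\<^sup>2 - d\<^sup>2))\<^sup>2 + (2 * a * b - 2 * c * d)\<^sup>2"
    by algebra
  also have "\<dots> = (fst p - fst q)\<^sup>2 + (\<bar>snd p\<bar> - \<bar>snd q\<bar>)\<^sup>2"
    using parabolic_fst[of p] parabolic_fst[of q] parabolic_abs_snd[of p] parabolic_abs_snd[of q]
    by (simp add: p q)
  also have "\<dots> \<le> (fst p - fst q)\<^sup>2 + (snd p - snd q)\<^sup>2"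
    by (simp flip: abs_le_square_iff)
  also have "\<dots> = (norm (p - q))\<^sup>2"
    by (simp add: norm_prod_def)
  finally show "(norm (parabolic p - parabolic q) * norm (parabolic p + parabolic q))\<^sup>2 \<le> (norm (p - q))\<^sup>2" .
qed simp

lemma nearby_sum_norm_ge:
  fixes x s t u :: "'a::real_normed_vector"
  assumes k: "0 < k" "k < 1"
    and near: "norm (s - x) \<le> (1 - k) / 2 * norm x" "norm (t - x) \<le> (1 - k) / 2 * norm x"
      "norm (u - x) \<le> (1 - k) / 2 * norm x"
  shows "k * (2 * norm u) \<le> norm (t + s)"
proof -
  have "norm u \<le> norm x + norm (u - x)"
    using norm_triangle_ineq[of x "u - x"] by simp
  then have "norm u \<le> (3 - k) / 2 * norm x"
    using near(3) by (simp add: field_simps)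
  then have "k * (2 * norm u) \<le> k * (2 * ((3 - k) / 2 * norm x))"
    using k(1) by (intro mult_left_mono) auto
  also have "\<dots> = (1 + k) * norm x - (1 - k)\<^sup>2 * norm x"
    by (simp add: power2_eq_square field_simps)
  also have "\<dots> \<le> (1 + k) * norm x"
    by simp
  also have "\<dots> = norm (2 *\<^sub>R x) - 2 * ((1 - k) / 2 * norm x)"
    by (simp add: field_simps)
  also have "\<dots> \<le> norm (2 *\<^sub>R x) - norm (t - x) - norm (s - x)"
    using near by simp
  also have "\<dots> \<le> norm (t + s)"
    using norm_triangle_ineq4[of "t + s" "(t - x) + (s - x)"] norm_triangle_ineq[of "t - x" "s - x"]
    by (simp add: scaleR_2)
  finally show ?thesis .
qed

lemma norm_parabolic_diff_le_integral_nearby: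
  fixes p :: "real \<Rightarrow> real \<times> real" and g :: "real \<Rightarrow> real"
  defines "F \<equiv> \<lambda>u. 1 / (2 * norm (parabolic (p u))) * g u"
  assumes k: "0 < k" "k < 1" and x: "x \<in> {s..t}" and p: "\<And>u. u \<in> {s..t} \<Longrightarrow> p u \<noteq> 0"
    and near: "\<And>u. u \<in> {s..t} \<Longrightarrow>
      norm (parabolic (p u) - parabolic (p x)) \<le> (1 - k) / 2 * norm (parabolic (p x))"
    and g: "g integrable_on {s..t}" "\<And>u. 0 \<le> g u" and F: "F integrable_on {s..t}"
    and pg: "norm (p t - p s) \<le> integral {s..t} g"
  shows "k * norm (parabolic (p t) - parabolic (p s)) \<le> integral {s..t} F"
proof -
  let ?sum = "norm (parabolic (p t) + parabolic (p s))"
  have le_sum: "k * (2 * norm (parabolic (p u))) \<le> ?sum" if "u \<in> {s..t}" for u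
    using k near[of s] near[of t] near[OF that] x by (intro nearby_sum_norm_ge) auto
  have "0 < k * (2 * norm (parabolic (p x)))"
    unfolding norm_parabolic using k(1) p[OF x] by simp
  then have sum_pos: "0 < ?sum"
    using le_sum[OF x] by linarith
  have "k * norm (parabolic (p t) - parabolic (p s)) * ?sum \<le> k * norm (p t - p s)"
    using norm_parabolic_diff_mult_sum_le k(1) by (simp add: mult.assoc)
  also have "\<dots> \<le> k * integral {s..t} g"
    using pg k(1) by (intro mult_left_mono) auto
  also have "\<dots> = integral {s..t} (\<lambda>u. k * g u)"
    by simp
  also have "\<dots> \<le> integral {s..t} (\<lambda>u. ?sum * F u)"
  proof (intro integral_le integrable_on_mult_right g F)
    fix u assume u: "u \<in> {s..t}"
    have "norm (parabolic (p u)) > 0"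
      unfolding norm_parabolic using p[OF u] by simp
    then have "k * g u = k * (2 * norm (parabolic (p u))) * F u"
      by (simp add: F_def)
    also have "\<dots> \<le> ?sum * F u"
      using g(2) by (intro mult_right_mono le_sum u) (simp add: F_def)
    finally show "k * g u \<le> ?sum * F u" .
  qed
  also have "\<dots> = integral {s..t} F * ?sum"
    by simp
  finally show ?thesis
    using sum_pos by simp
qed

lemma norm_parabolic_diff_le_integral:
  fixes p :: "real \<Rightarrow> real \<times> real" and g :: "real \<Rightarrow> real"
  assumes ab: "a \<le> b" and p: "continuous_on {a..b} p" "\<And>t. t \<in> {a..b} \<Longrightarrow> p t \<noteq> 0"
    and g: "g integrable_on {a..b}" "\<And>t. 0 \<le> g t"
    and pg: "\<And>s t. \<lbrakk>a \<le> s; s \<le> t; t \<le> b\<rbrakk> \<Longrightarrow> norm (p t - p s) \<le> integral {s..t} g"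
  shows "norm (parabolic (p b) - parabolic (p a))
    \<le> integral {a..b} (\<lambda>t. 1 / (2 * norm (parabolic (p t))) * g t)"
proof -
  let ?z = "\<lambda>t. parabolic (p t)"
  let ?F = "\<lambda>t. 1 / (2 * norm (?z t)) * g t"
  have z_cont: "continuous_on {a..b} ?z"
    by (intro continuous_on_parabolic p)
  have z_pos: "norm (?z t) > 0" if "t \<in> {a..b}" for t
    unfolding norm_parabolic using p(2)[OF that] by simp
  have F_int: "?F integrable_on {a..b}"
    using z_pos by (intro integrable_on_continuous_mult continuous_intros z_cont g) force
  show ?thesis
  proof (rule norm_diff_le_integral_if_locally[OF ab F_int])
    fix x k :: real assume x: "x \<in> {a..b}" and k: "0 < k" "k < 1"
    have "(1 - k) / 2 * norm (?z x) > 0"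
      using k z_pos[OF x] by simp
    then obtain d where d: "d > 0"
      "\<And>u. \<lbrakk>u \<in> {a..b}; dist u x < d\<rbrakk> \<Longrightarrow> dist (?z u) (?z x) < (1 - k) / 2 * norm (?z x)"
      using z_cont x unfolding continuous_on_iff by blast
    have "k * norm (?z t - ?z s) \<le> integral {s..t} ?F"
      if st: "a \<le> s" "s \<le> x" "x \<le> t" "t \<le> b" "t - s < d" for s t
    proof (rule norm_parabolic_diff_le_integral_nearby[OF k, of x])
      show "norm (?z u - ?z x) \<le> (1 - k) / 2 * norm (?z x)" if "u \<in> {s..t}" for u
      proof -
        have "dist u x < d" using that st by (auto simp: dist_real_def)
        then show ?thesis using d(2)[of u] that st by (simp add: dist_norm)
      qed
      show "g integrable_on {s..t}" "?F integrable_on {s..t}"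
        by (rule integrable_on_subinterval[OF g(1)] integrable_on_subinterval[OF F_int]; use st in auto)+
    qed (use st p(2) g(2) pg in auto)
    then show "\<exists>d>0. \<forall>s t. a \<le> s \<and> s \<le> x \<and> x \<le> t \<and> t \<le> b \<and> t - s < d \<longrightarrow>
        k * norm (?z t - ?z s) \<le> integral {s..t} ?F"
      using d(1) by blast
  qed
qed

lemma norm_parabolic_diff_power2_le:
  fixes p :: "real \<Rightarrow> real \<times> real" and g :: "real \<Rightarrow> real"
  assumes ab: "a \<le> b" and p: "continuous_on {a..b} p" "\<And>t. t \<in> {a..b} \<Longrightarrow> p t \<noteq> 0"
    and g: "g integrable_on {a..b}" "(\<lambda>t. (g t)\<^sup>2) integrable_on {a..b}" "\<And>t. 0 \<le> g t"
    and pg: "\<And>s t. \<lbrakk>a \<le> s; s \<le> t; t \<le> b\<rbrakk> \<Longrightarrow> norm (p t - p s) \<le> integral {s..t} g"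
  shows "(norm (parabolic (p b) - parabolic (p a)))\<^sup>2
    \<le> integral {a..b} (\<lambda>t. 1 / norm (p t)) * integral {a..b} (\<lambda>t. (g t)\<^sup>2 / 4)"
proof -
  define f where "f t = 1 / sqrt (norm (p t))" for t
  have f_cont: "continuous_on {a..b} f"
    unfolding f_def[abs_def] using p by (intro continuous_intros) auto
  have "norm (parabolic (p b) - parabolic (p a)) \<le> integral {a..b} (\<lambda>t. f t * (g t / 2))"
    using norm_parabolic_diff_le_integral[OF ab p g(1,3) pg] by (simp add: norm_parabolic f_def mult.commute)
  then have "(norm (parabolic (p b) - parabolic (p a)))\<^sup>2 \<le> (integral {a..b} (\<lambda>t. f t * (g t / 2)))\<^sup>2"
    by (intro power_mono) auto
  also have "\<dots> \<le> integral {a..b} (\<lambda>t. (f t)\<^sup>2) * integral {a..b} (\<lambda>t. (g t / 2)\<^sup>2)"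
  proof (rule Cauchy_Schwarz_integral)
    show "(\<lambda>t. (f t)\<^sup>2) integrable_on {a..b}"
      by (intro integrable_continuous_real continuous_intros f_cont)
    show "(\<lambda>t. (g t / 2)\<^sup>2) integrable_on {a..b}"
      using integrable_on_divide[OF g(2), of 4] by (simp add: power_divide)
    show "(\<lambda>t. f t * (g t / 2)) integrable_on {a..b}"
      by (intro integrable_on_continuous_mult f_cont integrable_on_divide g(1)) (simp add: g(3))
  qed
  finally show ?thesis
    by (simp add: f_def power_divide)
qed

text \<open>Lifting a path into the open upper half-plane removes its collisions at no cost in speed, so
  that the estimate above applies; letting \<open>e\<close> tend to 0 recovers the original path.\<close>

definition lift_path :: "real \<Rightarrow> real \<times> real \<Rightarrow> real \<times> real" where
  "lift_path e p = (fst p, norm (snd p, e))"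

lemma norm_lift_path_diff_le: "norm (lift_path e p - lift_path e q) \<le> norm (p - q)"
proof -
  have "\<bar>norm (snd p, e) - norm (snd q, e)\<bar> \<le> norm (snd p - snd q, 0::real)"
    using norm_triangle_ineq3[of "(snd p, e)" "(snd q, e)"] by simp
  then have "(norm (snd p, e) - norm (snd q, e))\<^sup>2 \<le> (snd p - snd q)\<^sup>2"
    by (simp add: norm_Pair abs_le_square_iff)
  then show ?thesis by (simp add: lift_path_def norm_prod_def)
qed

lemma norm_le_norm_lift_path: "norm p \<le> norm (lift_path e p)"
  by (simp add: lift_path_def norm_prod_def)

lemma lift_path_nonzero: "e \<noteq> 0 \<Longrightarrow> lift_path e p \<noteq> 0"
  by (simp add: lift_path_def zero_prod_def)

lemma parabolic_lift_path_zero: "parabolic (lift_path 0 p) = parabolic p"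
  by (simp add: lift_path_def parabolic_def norm_prod_def)

lemma norm_parabolic_lift_path_diff_power2_le:
  assumes v: "L2_deriv a b q v" and q: "finite_potential {a..b} q" and e: "e \<noteq> 0" and ab: "a \<le> b"
  shows "(norm (parabolic (lift_path e (q b)) - parabolic (lift_path e (q a))))\<^sup>2
    \<le> integral {a..b} (\<lambda>t. 1 / norm (q t)) * integral {a..b} (\<lambda>t. (norm (v t))\<^sup>2 / 4)"
proof -
  let ?p = "\<lambda>t. lift_path e (q t)"
  have p_cont: "continuous_on {a..b} ?p"
    unfolding lift_path_def by (intro continuous_intros L2_deriv_continuous[OF v])
  have p_nonzero: "?p t \<noteq> 0" for t
    using e by (rule lift_path_nonzero)
  have "norm (?p t - ?p s) \<le> integral {s..t} (\<lambda>u. norm (v u))" if st: "a \<le> s" "s \<le> t" "t \<le> b" for s t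
  proof -
    have "norm (?p t - ?p s) \<le> norm (q t - q s)"
      by (rule norm_lift_path_diff_le)
    also have "\<dots> = norm (integral {s..t} v)"
      using L2_deriv_has_integral[OF v st] by (simp add: integral_unique)
    also have "\<dots> \<le> integral {s..t} (\<lambda>u. norm (v u))"
      using L2_deriv_integrable[OF v st(1,3)] by (intro integral_norm_bound_integral) auto
    finally show ?thesis .
  qed
  then have "(norm (parabolic (?p b) - parabolic (?p a)))\<^sup>2
      \<le> integral {a..b} (\<lambda>t. 1 / norm (?p t)) * integral {a..b} (\<lambda>t. (norm (v t))\<^sup>2 / 4)"
    using ab p_cont p_nonzero L2_deriv_integrable[OF v order_refl order_refl]
    by (intro norm_parabolic_diff_power2_le) auto
  also have "\<dots> \<le> integral {a..b} (\<lambda>t. 1 / norm (q t)) * integral {a..b} (\<lambda>t. (norm (v t))\<^sup>2 / 4)"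
    using q p_cont p_nonzero norm_le_norm_lift_path L2_deriv_integrable(3)[OF v order_refl order_refl]
    by (intro mult_right_mono integral_inverse_norm_mono integral_nonneg integrable_on_divide) auto
  finally show ?thesis .
qed

lemma parabolic_energy_bound:
  assumes v: "L2_deriv a b q v" and q: "finite_potential {a..b} q" and ab: "a \<le> b"
  shows "(norm (parabolic (q b) - parabolic (q a)))\<^sup>2
    \<le> integral {a..b} (\<lambda>t. 1 / norm (q t)) * integral {a..b} (\<lambda>t. (norm (v t))\<^sup>2 / 4)"
proof (rule tendsto_upperbound)
  have "continuous_on UNIV (\<lambda>e. parabolic (lift_path e x))" for x
    unfolding lift_path_def by (intro continuous_on_parabolic continuous_intros)
  then have "((\<lambda>e. parabolic (lift_path e x)) \<longlongrightarrow> parabolic (lift_path 0 x)) (at_right 0)" for x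
    unfolding continuous_on_eq_continuous_at[OF open_UNIV] isCont_def
    by (blast intro: tendsto_within_subset)
  then show "((\<lambda>e. (norm (parabolic (lift_path e (q b)) - parabolic (lift_path e (q a))))\<^sup>2)
      \<longlongrightarrow> (norm (parabolic (q b) - parabolic (q a)))\<^sup>2) (at_right 0)"
    unfolding parabolic_lift_path_zero by (intro tendsto_intros)
  show "\<forall>\<^sub>F e in at_right 0.
      (norm (parabolic (lift_path e (q b)) - parabolic (lift_path e (q a))))\<^sup>2
      \<le> integral {a..b} (\<lambda>t. 1 / norm (q t)) * integral {a..b} (\<lambda>t. (norm (v t))\<^sup>2 / 4)"
    using norm_parabolic_lift_path_diff_power2_le[OF v q _ ab]
    by (intro eventually_mono[OF eventually_at_right_less]) auto
qed simp

section \<open>Symmetrization in Levi-Civita time\<close>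

locale finite_action_path =
  fixes T :: real and q v :: "real \<Rightarrow> real \<times> real"
  assumes T_pos: "T > 0" and deriv: "L2_deriv 0 T q v" and potential: "finite_potential {0..T} q"
begin

definition lc_time :: "real \<Rightarrow> real" where
  "lc_time t = integral {0..t} (\<lambda>u. 1 / norm (q u))"

definition lc_duration :: real where
  "lc_duration = lc_time T"

lemma q_continuous: "continuous_on {0..T} q"
  by (rule L2_deriv_continuous[OF deriv])

lemma q_bounded: "\<exists>M>0. \<forall>t\<in>{0..T}. norm (q t) \<le> M"
proof -
  have "bounded (q ` {0..T})"
    by (intro compact_imp_bounded compact_continuous_image q_continuous) auto
  then show ?thesis by (auto simp: bounded_pos)
qed

lemma lc_time_zero: "lc_time 0 = 0"
  by (simp add: lc_time_def)

lemma has_integral_lc_time: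
  assumes "0 \<le> s" "s \<le> t" "t \<le> T"
  shows "((\<lambda>u. 1 / norm (q u)) has_integral lc_time t - lc_time s) {s..t}"
proof -
  have "integral {s..t} (\<lambda>u. 1 / norm (q u)) = lc_time t - lc_time s"
    using assms Henstock_Kurzweil_Integration.integral_combine[of 0 s t "\<lambda>u. 1 / norm (q u)"]
      finite_potential_integrable[OF potential, of 0 t] by (simp add: lc_time_def)
  then show ?thesis
    using finite_potential_integrable[OF potential, of s t] assms by (simp add: has_integral_iff)
qed

lemma continuous_on_lc_time: "continuous_on {0..T} lc_time"
  unfolding lc_time_def[abs_def]
  by (intro indefinite_integral_continuous_1 finite_potential_integrable[OF potential]) auto

lemma time_increment_between:
  assumes st: "0 \<le> s" "s \<le> t" "t \<le> T" and bounds: "\<And>u. u \<in> {s..t} \<Longrightarrow> m \<le> norm (q u) \<and> norm (q u) \<le> M"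
  shows "m * (lc_time t - lc_time s) \<le> t - s" "t - s \<le> M * (lc_time t - lc_time s)"
proof -
  have "((\<lambda>u. 1) has_integral t - s) {s..t}"
    using has_integral_const_real[of "1::real" s t] st by simp
  then have one: "((\<lambda>u. norm (q u) * (1 / norm (q u))) has_integral t - s) {s..t}"
    by (rule has_integral_spike[OF finite_potential_negligible[OF potential], rotated])
      (use st in auto)
  note lc = has_integral_mult_right[OF has_integral_lc_time[OF st]]
  show "m * (lc_time t - lc_time s) \<le> t - s"
    using lc[of m] one by (rule has_integral_le) (use bounds in \<open>auto intro: divide_right_mono\<close>)
  show "t - s \<le> M * (lc_time t - lc_time s)"
    using one lc[of M] by (rule has_integral_le) (use bounds in \<open>auto intro: divide_right_mono\<close>)
qed

lemma lc_time_strict_mono: "lc_time s < lc_time t" if "0 \<le> s" "s < t" "t \<le> T"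
proof -
  obtain M where "M > 0" "\<forall>t\<in>{0..T}. norm (q t) \<le> M"
    using q_bounded by blast
  then have "0 < M * (lc_time t - lc_time s)"
    using time_increment_between(2)[of s t 0 M] that by simp
  with \<open>M > 0\<close> show ?thesis
    by (simp add: zero_less_mult_iff)
qed

lemma lc_time_mono: "lc_time s \<le> lc_time t" if "0 \<le> s" "s \<le> t" "t \<le> T"
  using lc_time_strict_mono[of s t] that by (cases "s = t") auto

lemma lc_duration_pos: "lc_duration > 0"
  using lc_time_strict_mono[of 0 T] T_pos by (simp add: lc_duration_def lc_time_zero)

lemma bij_betw_lc_time: "bij_betw lc_time {0..T} {0..lc_duration}"
proof -
  have "inj_on lc_time {0..T}"
    by (rule linorder_inj_onI) (use lc_time_strict_mono in force)+
  moreover have "lc_time t \<in> {0..lc_duration}" if "t \<in> {0..T}" for t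
    using that lc_time_mono[of 0 t] lc_time_mono[of t T] by (simp add: lc_duration_def lc_time_zero)
  moreover have "\<exists>t\<in>{0..T}. lc_time t = s" if "s \<in> {0..lc_duration}" for s
    using IVT'[of lc_time 0 s T] that continuous_on_lc_time T_pos
    by (auto simp: lc_duration_def lc_time_zero)
  ultimately show ?thesis
    by (force simp: bij_betw_def)
qed

definition physical_time :: "real \<Rightarrow> real" where
  "physical_time = inv_into {0..T} lc_time"

lemma lc_time_physical_time: "s \<in> {0..lc_duration} \<Longrightarrow> lc_time (physical_time s) = s"
  unfolding physical_time_def by (rule bij_betw_inv_into_right[OF bij_betw_lc_time])

lemma physical_time_lc_time: "t \<in> {0..T} \<Longrightarrow> physical_time (lc_time t) = t"
  unfolding physical_time_def by (rule bij_betw_inv_into_left[OF bij_betw_lc_time])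

lemma physical_time_mem: "s \<in> {0..lc_duration} \<Longrightarrow> physical_time s \<in> {0..T}"
  unfolding physical_time_def using bij_betw_inv_into[OF bij_betw_lc_time] by (auto simp: bij_betw_def)

lemma physical_time_ends: "physical_time 0 = 0" "physical_time lc_duration = T"
  using physical_time_lc_time[of 0] physical_time_lc_time[of T] T_pos
  by (simp_all add: lc_time_zero lc_duration_def)

lemma physical_time_mono: "physical_time r \<le> physical_time s" if "0 \<le> r" "r \<le> s" "s \<le> lc_duration"
proof (rule ccontr)
  assume "\<not> physical_time r \<le> physical_time s"
  then have "lc_time (physical_time s) < lc_time (physical_time r)"
    using physical_time_mem[of r] physical_time_mem[of s] that by (intro lc_time_strict_mono) auto
  then show False
    using that by (simp add: lc_time_physical_time)
qed

lemma continuous_on_physical_time: "continuous_on {0..lc_duration} physical_time"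
proof -
  have "continuous_on (lc_time ` {0..T}) physical_time"
    by (intro continuous_on_inv continuous_on_lc_time) (auto simp: physical_time_lc_time)
  then show ?thesis
    using bij_betw_lc_time by (simp add: bij_betw_def)
qed

definition lc_path :: "real \<Rightarrow> real \<times> real" where
  "lc_path s = parabolic (q (physical_time s))"

definition xi :: "real \<Rightarrow> real" where "xi s = fst (lc_path s)"

definition eta :: "real \<Rightarrow> real" where "eta s = snd (lc_path s)"

lemma continuous_on_q_physical_time: "continuous_on {0..lc_duration} (\<lambda>s. q (physical_time s))"
  using physical_time_mem by (intro continuous_on_compose2[OF q_continuous continuous_on_physical_time]) auto

lemma continuous_on_xi: "continuous_on {0..lc_duration} xi"
  and continuous_on_eta: "continuous_on {0..lc_duration} eta"
  unfolding xi_def[abs_def] eta_def[abs_def] lc_path_def[abs_def]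
  by (intro continuous_intros continuous_on_parabolic continuous_on_q_physical_time)+

lemma norm_q_physical_time: "norm (q (physical_time s)) = (xi s)\<^sup>2 + (eta s)\<^sup>2"
  and fst_q_physical_time: "fst (q (physical_time s)) = (xi s)\<^sup>2 - (eta s)\<^sup>2"
  by (simp_all add: xi_def eta_def lc_path_def parabolic_squares field_simps)

lemma physical_time_increment_near:
  assumes xy: "0 \<le> x" "x \<le> y" "y \<le> lc_duration"
    and near: "\<And>s. s \<in> {x..y} \<Longrightarrow> \<bar>norm (q (physical_time s)) - c\<bar> \<le> e"
  shows "\<bar>physical_time y - physical_time x - c * (y - x)\<bar> \<le> e * (y - x)"
proof -
  have mem: "0 \<le> physical_time x" "physical_time x \<le> physical_time y" "physical_time y \<le> T"
    using physical_time_mem[of x] physical_time_mem[of y] physical_time_mono[OF xy] xy by auto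
  have lc: "lc_time (physical_time x) = x" "lc_time (physical_time y) = y"
    using xy by (simp_all add: lc_time_physical_time)
  have "c - e \<le> norm (q t) \<and> norm (q t) \<le> c + e" if t: "t \<in> {physical_time x..physical_time y}" for t
  proof -
    have "lc_time t \<in> {x..y}"
      using lc_time_mono[of "physical_time x" t] lc_time_mono[of t "physical_time y"] t mem
      unfolding lc by auto
    moreover have "physical_time (lc_time t) = t"
      using t mem by (intro physical_time_lc_time) auto
    ultimately show ?thesis
      using near[of "lc_time t"] by (auto simp: abs_le_iff)
  qed
  from time_increment_between[OF mem this] show ?thesis
    by (simp add: lc abs_le_iff algebra_simps)
qed

text \<open>Since \<open>dt = r ds\<close>, physical time is continuously differentiable in Levi-Civita time even at
  collisions.\<close>

lemma physical_time_has_derivative: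
  assumes s: "s \<in> {0..lc_duration}"
  shows "(physical_time has_real_derivative norm (q (physical_time s))) (at s within {0..lc_duration})"
proof -
  let ?f = "\<lambda>s. norm (q (physical_time s))"
  have "\<exists>d>0. \<forall>y\<in>{0..lc_duration}. norm (y - s) < d \<longrightarrow>
      norm (physical_time y - physical_time s - ?f s * (y - s)) \<le> e * norm (y - s)" if e: "e > 0" for e
  proof -
    have "continuous_on {0..lc_duration} ?f"
      by (intro continuous_intros continuous_on_q_physical_time)
    then obtain d where d: "d > 0" "\<And>u. \<lbrakk>u \<in> {0..lc_duration}; dist u s < d\<rbrakk> \<Longrightarrow> dist (?f u) (?f s) < e"
      using s e unfolding continuous_on_iff by blast
    have near: "\<bar>?f u - ?f s\<bar> \<le> e" if "u \<in> {0..lc_duration}" "\<bar>u - s\<bar> < d" for u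
      using d(2)[OF that(1)] that(2) by (simp add: dist_real_def)
    have "norm (physical_time y - physical_time s - ?f s * (y - s)) \<le> e * norm (y - s)"
      if y: "y \<in> {0..lc_duration}" "norm (y - s) < d" for y
    proof (cases "s \<le> y")
      case True
      then show ?thesis
        using physical_time_increment_near[of s y "?f s" e] near s y by auto
    next
      case False
      then have "\<bar>physical_time s - physical_time y - ?f s * (s - y)\<bar> \<le> e * (s - y)"
        using physical_time_increment_near[of y s "?f s" e] near s y by auto
      then show ?thesis
        using False by (simp add: abs_le_iff algebra_simps)
    qed
    then show ?thesis
      using d(1) by blast
  qed
  then show ?thesis
    unfolding has_field_derivative_def has_derivative_within_alt
    by (auto intro: bounded_linear_mult_right)
qed

lemma integral_in_lc_time:
  fixes f :: "real \<Rightarrow> real"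
  assumes "continuous_on {0..T} f"
  shows "integral {0..T} f
    = integral {0..lc_duration} (\<lambda>s. ((xi s)\<^sup>2 + (eta s)\<^sup>2) * f (physical_time s))"
proof -
  have "((\<lambda>s. norm (q (physical_time s)) *\<^sub>R f (physical_time s)) has_integral
      integral {physical_time 0..physical_time lc_duration} f) {0..lc_duration}"
    using assms lc_duration_pos T_pos physical_time_mem
    by (intro has_integral_substitution[where c = 0 and d = T] physical_time_has_derivative)
      (auto simp: physical_time_ends)
  then show ?thesis
    by (simp add: physical_time_ends norm_q_physical_time integral_unique)
qed

lemma lc_constraint:
  "integral {0..lc_duration} (\<lambda>s. (xi s)\<^sup>2) + integral {0..lc_duration} (\<lambda>s. (eta s)\<^sup>2) = T"
proof -
  have "T = integral {0..lc_duration} (\<lambda>s. (xi s)\<^sup>2 + (eta s)\<^sup>2)"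
    using integral_in_lc_time[of "\<lambda>t. 1"] T_pos by simp
  also have "\<dots> = integral {0..lc_duration} (\<lambda>s. (xi s)\<^sup>2) + integral {0..lc_duration} (\<lambda>s. (eta s)\<^sup>2)"
    by (intro integral_add integrable_continuous_real continuous_intros continuous_on_xi continuous_on_eta)
  finally show ?thesis by simp
qed

definition quarter_energy :: real where
  "quarter_energy = integral {0..T} (\<lambda>t. (norm (v t))\<^sup>2 / 4)"

lemma real_action_in_lc_time:
  "real_action T q v = 2 * quarter_energy + lc_duration
    + integral {0..lc_duration} (\<lambda>s. xi s ^ 4) - integral {0..lc_duration} (\<lambda>s. eta s ^ 4)"
proof -
  have "integral {0..T} (\<lambda>t. (norm (v t))\<^sup>2 / 2) = 2 * quarter_energy"
    by (simp add: quarter_energy_def)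
  moreover have "integral {0..T} (\<lambda>t. 1 / norm (q t)) = lc_duration"
    by (simp add: lc_duration_def lc_time_def)
  moreover have "integral {0..T} (\<lambda>t. fst (q t))
      = integral {0..lc_duration} (\<lambda>s. ((xi s)\<^sup>2 + (eta s)\<^sup>2) * ((xi s)\<^sup>2 - (eta s)\<^sup>2))"
    using integral_in_lc_time[of "\<lambda>t. fst (q t)"] q_continuous
    by (simp add: fst_q_physical_time continuous_on_fst)
  moreover have "((xi s)\<^sup>2 + (eta s)\<^sup>2) * ((xi s)\<^sup>2 - (eta s)\<^sup>2) = xi s ^ 4 - eta s ^ 4" for s
    by algebra
  moreover have "integral {0..lc_duration} (\<lambda>s. xi s ^ 4 - eta s ^ 4)
      = integral {0..lc_duration} (\<lambda>s. xi s ^ 4) - integral {0..lc_duration} (\<lambda>s. eta s ^ 4)"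
    by (intro integral_diff integrable_continuous_real continuous_intros continuous_on_xi continuous_on_eta)
  ultimately show ?thesis
    by (simp add: real_action_def)
qed

lemma discrete_energy_lc_path_le:
  assumes N: "N > 0"
  shows "discrete_energy lc_duration N lc_path \<le> quarter_energy"
proof -
  let ?w = "\<lambda>t. (norm (v t))\<^sup>2 / 4" and ?t = "\<lambda>i. physical_time (grid lc_duration N i)"
  have S: "lc_duration \<ge> 0" using lc_duration_pos by simp
  have grid: "0 \<le> grid lc_duration N i" "grid lc_duration N i \<le> grid lc_duration N (Suc i)"
    "grid lc_duration N (Suc i) \<le> lc_duration" if "i < N" for i
    using that grid_mem[OF S, of i N] grid_mem[OF S, of "Suc i" N] grid_mono[OF S, of N i] by auto
  have w: "?w integrable_on {0..T}"
    by (intro integrable_on_divide L2_deriv_integrable(3)[OF deriv]) auto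
  have "(\<Sum>i<N. (norm (lc_path (grid lc_duration N (Suc i)) - lc_path (grid lc_duration N i)))\<^sup>2)
      \<le> (\<Sum>i<N. lc_duration / N * integral {?t i..?t (Suc i)} ?w)"
  proof (rule sum_mono)
    fix i assume "i \<in> {..<N}"
    then have i: "i < N" by simp
    have t: "0 \<le> ?t i" "?t i \<le> ?t (Suc i)" "?t (Suc i) \<le> T"
      using physical_time_mono[OF grid[OF i]] physical_time_mem[of "grid lc_duration N i"]
        physical_time_mem[of "grid lc_duration N (Suc i)"] grid[OF i] by auto
    have "integral {?t i..?t (Suc i)} (\<lambda>u. 1 / norm (q u)) = lc_time (?t (Suc i)) - lc_time (?t i)"
      by (rule integral_unique[OF has_integral_lc_time[OF t]])
    also have "\<dots> = lc_duration / N"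
      using grid[OF i] by (simp add: lc_time_physical_time grid_step)
    finally show "(norm (lc_path (grid lc_duration N (Suc i)) - lc_path (grid lc_duration N i)))\<^sup>2
        \<le> lc_duration / N * integral {?t i..?t (Suc i)} ?w"
      using parabolic_energy_bound[OF L2_deriv_subinterval[OF deriv t(1,3)]
          finite_potential_subset[OF potential] t(2)] t by (simp add: lc_path_def)
  qed
  also have "\<dots> = lc_duration / N * integral {?t 0..?t N} ?w"
    unfolding sum_distrib_left[symmetric] using N w physical_time_mono[OF grid]
    by (subst sum_integral_adjacent) (auto simp: grid_ends physical_time_ends)
  also have "\<dots> = lc_duration / N * quarter_energy"
    using N by (simp add: grid_ends physical_time_ends quarter_energy_def)
  finally show ?thesis
    unfolding discrete_energy_def using N lc_duration_pos by (simp add: field_simps)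
qed

definition symmetrized_profile :: "real \<Rightarrow> real" where
  "symmetrized_profile s = norm (eta s, xi (lc_duration - s))"

lemma continuous_on_xi_reflected: "continuous_on {0..lc_duration} (\<lambda>s. xi (lc_duration - s))"
  by (intro continuous_on_compose2[OF continuous_on_xi] continuous_intros) auto

lemma continuous_on_symmetrized_profile: "continuous_on {0..lc_duration} symmetrized_profile"
  unfolding symmetrized_profile_def[abs_def]
  by (intro continuous_intros continuous_on_eta continuous_on_xi_reflected)

lemma symmetrized_profile_power2: "(symmetrized_profile s)\<^sup>2 = (eta s)\<^sup>2 + (xi (lc_duration - s))\<^sup>2"
  by (simp add: symmetrized_profile_def norm_prod_def)

lemma integral_symmetrized_profile_power2:
  "integral {0..lc_duration} (\<lambda>s. (symmetrized_profile s)\<^sup>2) = T"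
proof -
  have "integral {0..lc_duration} (\<lambda>s. (symmetrized_profile s)\<^sup>2)
      = integral {0..lc_duration} (\<lambda>s. (eta s)\<^sup>2) + integral {0..lc_duration} (\<lambda>s. (xi (lc_duration - s))\<^sup>2)"
    unfolding symmetrized_profile_power2
    by (intro integral_add integrable_continuous_real continuous_intros continuous_on_eta
        continuous_on_xi_reflected)
  also have "integral {0..lc_duration} (\<lambda>s. (xi (lc_duration - s))\<^sup>2) = integral {0..lc_duration} (\<lambda>s. (xi s)\<^sup>2)"
    using lc_duration_pos by (intro integral_reflect_interval continuous_intros continuous_on_xi) auto
  finally show ?thesis
    using lc_constraint by simp
qed

lemma integral_symmetrized_profile_power4_ge:
  "integral {0..lc_duration} (\<lambda>s. eta s ^ 4) + integral {0..lc_duration} (\<lambda>s. xi s ^ 4)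
    \<le> integral {0..lc_duration} (\<lambda>s. symmetrized_profile s ^ 4)"
proof -
  have "integral {0..lc_duration} (\<lambda>s. xi s ^ 4) = integral {0..lc_duration} (\<lambda>s. xi (lc_duration - s) ^ 4)"
    using lc_duration_pos
    by (intro integral_reflect_interval[symmetric] continuous_intros continuous_on_xi) auto
  then have "integral {0..lc_duration} (\<lambda>s. eta s ^ 4) + integral {0..lc_duration} (\<lambda>s. xi s ^ 4)
      = integral {0..lc_duration} (\<lambda>s. eta s ^ 4 + xi (lc_duration - s) ^ 4)"
    by (simp add: integral_add integrable_continuous_real continuous_on_power continuous_on_eta
        continuous_on_xi_reflected)
  also have "\<dots> \<le> integral {0..lc_duration} (\<lambda>s. symmetrized_profile s ^ 4)"
  proof (intro integral_le integrable_continuous_real continuous_intros continuous_on_eta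
      continuous_on_xi_reflected continuous_on_symmetrized_profile)
    fix s
    have "symmetrized_profile s ^ 4 = ((symmetrized_profile s)\<^sup>2)\<^sup>2"
      by simp
    also have "\<dots> = eta s ^ 4 + xi (lc_duration - s) ^ 4 + 2 * (eta s)\<^sup>2 * (xi (lc_duration - s))\<^sup>2"
      unfolding symmetrized_profile_power2 by algebra
    finally show "eta s ^ 4 + xi (lc_duration - s) ^ 4 \<le> symmetrized_profile s ^ 4"
      by simp
  qed
  finally show ?thesis .
qed

lemma discrete_energy_symmetrized_profile_le:
  assumes "N > 0"
  shows "discrete_energy lc_duration N symmetrized_profile \<le> quarter_energy"
proof -
  have "discrete_energy lc_duration N symmetrized_profile
      \<le> discrete_energy lc_duration N (\<lambda>s. (eta s, xi (lc_duration - s)))"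
    unfolding symmetrized_profile_def[abs_def] using lc_duration_pos by (intro discrete_energy_norm_le) simp
  also have "\<dots> = discrete_energy lc_duration N (\<lambda>s. (xi s, eta s))"
    by (simp add: discrete_energy_Pair discrete_energy_reflect)
  also have "(\<lambda>s. (xi s, eta s)) = lc_path"
    by (simp add: xi_def eta_def)
  also have "discrete_energy lc_duration N lc_path \<le> quarter_energy"
    using assms by (rule discrete_energy_lc_path_le)
  finally show ?thesis .
qed

lemma xi_zero_if_real_action_minimal:
  assumes ends: "eta 0 = 0" "xi lc_duration = 0"
    and minimal: "radial_lower_bound T (real_action T q v)"
    and s: "s \<in> {0..lc_duration}"
  shows "xi s = 0"
proof -
  have "real_action T q v \<le> 2 * quarter_energy + lc_duration
      - integral {0..lc_duration} (\<lambda>s. symmetrized_profile s ^ 4)"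
    using ends
    by (intro radial_infimum_le_profile[OF lc_duration_pos T_pos continuous_on_symmetrized_profile _
          integral_symmetrized_profile_power2 discrete_energy_symmetrized_profile_le minimal])
      (simp_all add: symmetrized_profile_def)
  then have "integral {0..lc_duration} (\<lambda>s. xi s ^ 4) \<le> 0"
    using integral_symmetrized_profile_power4_ge unfolding real_action_in_lc_time by linarith
  moreover have "integral {0..lc_duration} (\<lambda>s. xi s ^ 4) \<ge> 0"
    by (intro integral_nonneg integrable_continuous_real continuous_intros continuous_on_xi) simp
  ultimately have "integral {0..lc_duration} (\<lambda>s. xi s ^ 4) = 0"
    by simp
  then have "\<forall>s\<in>{0..lc_duration}. xi s ^ 4 = 0"
    using lc_duration_pos by (subst (asm) integral_eq_0_iff) (auto intro!: continuous_intros continuous_on_xi)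
  then show ?thesis using s by simp
qed

lemma on_negative_axis_if_real_action_minimal:
  assumes ends: "snd (q 0) = 0" "snd (q T) = 0" "fst (q 0) \<ge> 0" "fst (q T) \<le> 0"
    and minimal: "radial_lower_bound T (real_action T q v)"
    and t: "t \<in> {0..T}"
  shows "snd (q t) = 0 \<and> fst (q t) \<le> 0"
proof -
  have lc_t: "lc_time t \<in> {0..lc_duration}"
    using bij_betw_lc_time t by (auto simp: bij_betw_def)
  have "eta 0 = 0" "xi lc_duration = 0"
    using ends by (simp_all add: eta_def xi_def lc_path_def physical_time_ends parabolic_def norm_prod_def)
  then have "xi (lc_time t) = 0"
    by (rule xi_zero_if_real_action_minimal[OF _ _ minimal lc_t])
  then have "fst (parabolic (q t)) = 0"
    by (simp add: xi_def lc_path_def physical_time_lc_time[OF t])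
  then have "fst (q t) = - (snd (parabolic (q t)))\<^sup>2" "\<bar>snd (q t)\<bar> = 0"
    using parabolic_fst[of "q t"] parabolic_abs_snd[of "q t"] by simp_all
  then show ?thesis by simp
qed

end

lemma radial_path_exists:
  assumes "T > 0"
  shows "\<exists>r v. radial_path 0 T r v \<and> r 0 = 0"
  using radial_polygon_rescaled[of 1 T 1 real] assms by auto

lemma minimizer_on_negative_axis:
  assumes T: "T > 0" and q: "global_minimizer T q"
  shows "action T q < \<infinity>" and "\<And>t. t \<in> {0..T} \<Longrightarrow> snd (q t) = 0 \<and> fst (q t) \<le> 0"
proof -
  obtain r w where "radial_path 0 T r w" "r 0 = 0"
    using radial_path_exists[OF T] by blast
  then have "action T q \<le> ereal (radial_action 0 T r w)"
    using q T by (intro action_minimizer_le_radial_action) auto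
  then show finite: "action T q < \<infinity>"
    by (auto simp: less_top[symmetric])
  obtain v where v: "H1_deriv T q v"
    using q by (auto simp: global_minimizer_def Omega_def H1_def)
  note potential = finite_potential_if_action_finite[OF v finite]
  interpret finite_action_path T q v
    using T v potential by unfold_locales (auto simp: H1_deriv_iff_L2_deriv)
  have "radial_lower_bound T (real_action T q v)"
    using q T action_eq_real_action[OF v potential] by (intro radial_lower_bound_minimizer) auto
  then show "snd (q t) = 0 \<and> fst (q t) \<le> 0" if "t \<in> {0..T}" for t
    using q that
    by (intro on_negative_axis_if_real_action_minimal) (auto simp: global_minimizer_def Omega_def)
qed

section \<open>Positivity of minimizers on the axis\<close>

lemma first_hitting_time:
  fixes r :: "real \<Rightarrow> real"
  assumes r: "continuous_on {a..b} r" "r a \<le> c" and ab: "a \<le> b"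
  obtains t where "t \<in> {a..b}" "\<And>x. x \<in> {a..t} \<Longrightarrow> r x \<le> c" "t < b \<Longrightarrow> r t = c"
proof (cases "\<forall>x\<in>{a..b}. r x \<le> c")
  case True
  then show ?thesis using ab by (intro that[of b]) auto
next
  case False
  have level: "\<exists>z\<in>{a..x}. r z = c" if "x \<in> {a..b}" "r x > c" for x
  proof -
    have "continuous_on {a..x} r"
      using r(1) by (rule continuous_on_subset) (use that(1) in auto)
    then show ?thesis
      using IVT'[of r a c x] r(2) that by auto
  qed
  define Z where "Z = {x \<in> {a..b}. r x = c}"
  have "compact Z"
    using continuous_closed_preimage_constant[OF r(1) closed_atLeastAtMost, of c]
    by (auto simp: Z_def compact_eq_bounded_closed intro: bounded_subset[OF bounded_closed_interval])
  moreover have "Z \<noteq> {}"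
    using False level by (fastforce simp: Z_def)
  ultimately obtain t where t: "t \<in> Z" "\<And>z. z \<in> Z \<Longrightarrow> t \<le> z"
    using compact_attains_inf by metis
  have "r x \<le> c" if "x \<in> {a..t}" for x
  proof (rule ccontr)
    assume "\<not> r x \<le> c"
    moreover have "x \<in> {a..b}"
      using that t(1) by (simp add: Z_def)
    ultimately obtain z where "z \<in> {a..x}" "r z = c"
      using level[of x] by auto
    then have "z = t"
      using that t(1) t(2)[of z] by (force simp: Z_def)
    then show False
      using that \<open>z \<in> {a..x}\<close> \<open>r z = c\<close> \<open>\<not> r x \<le> c\<close> by auto
  qed
  then show ?thesis
    using t(1) by (intro that[of t]) (auto simp: Z_def)
qed

locale radial_minimizer =
  fixes T :: real and r v :: "real \<Rightarrow> real"
  assumes T_pos: "T > 0" and radial: "radial_path 0 T r v" and r_start: "r 0 = 0"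
    and minimal: "radial_lower_bound T (radial_action 0 T r v)"
begin

lemma r_continuous: "0 \<le> a \<Longrightarrow> b \<le> T \<Longrightarrow> continuous_on {a..b} r"
  using L2_deriv_continuous[OF radial_pathD(1)[OF radial]] by (rule continuous_on_subset) auto

lemma r_nonneg: "t \<in> {0..T} \<Longrightarrow> r t \<ge> 0"
  by (rule radial_pathD(3)[OF radial])

lemma minimal_on_subinterval:
  assumes st: "0 \<le> s" "s \<le> t" "t \<le> T" and p: "radial_path s t p w" "p s = r s" "t < T \<Longrightarrow> p t = r t"
  shows "radial_action s t r v \<le> radial_action s t p w"
proof -
  define left left_speed where
    "left = (\<lambda>x. if x \<le> s then r x else p x)" and "left_speed = (\<lambda>x. if x \<le> s then v x else w x)"
  have start: "radial_path 0 s r v" "radial_path 0 t r v"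
    using radial_path_subinterval[OF radial] st by auto
  have left: "radial_path 0 t left left_speed"
    "radial_action 0 t left left_speed = radial_action 0 s r v + radial_action s t p w"
    unfolding left_def left_speed_def using radial_path_glue[OF start(1) p(1) st(1,2)] p(2) by auto
  have left_ends: "left 0 = 0" "t < T \<Longrightarrow> left t = r t"
    using st p(2,3) r_start by (auto simp: left_def)
  have split: "radial_action 0 s r v + radial_action s t r v = radial_action 0 t r v"
    by (rule radial_action_combine[OF start(2) st(1,2)])
  show ?thesis
  proof (cases "t = T")
    case True
    then show ?thesis
      using radial_lower_boundD[OF minimal, of left left_speed] left left_ends(1) split by simp
  next
    case False
    define full full_speed where
      "full = (\<lambda>x. if x \<le> t then left x else r x)" and
      "full_speed = (\<lambda>x. if x \<le> t then left_speed x else v x)"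
    have finish: "radial_path t T r v"
      using radial_path_subinterval[OF radial] st by auto
    have t: "0 \<le> t" "t \<le> T" "left t = r t"
      using False st left_ends(2) by auto
    have "radial_path 0 T full full_speed"
      "radial_action 0 T full full_speed = radial_action 0 t left left_speed + radial_action t T r v"
      unfolding full_def full_speed_def using radial_path_glue[OF left(1) finish t] by auto
    moreover have "full 0 = 0"
      using t left_ends by (simp add: full_def)
    ultimately show ?thesis
      using radial_lower_boundD[OF minimal, of full full_speed] left(2) split
        radial_action_combine[OF radial t(1,2)] by simp
  qed
qed

text \<open>Keeping the distance at an earlier maximum until it is reached again lowers all three terms of
  the action.\<close>

lemma r_pos: "r t > 0" if t: "0 < t" "t \<le> T"
proof (rule ccontr)
  assume "\<not> r t > 0"
  then have r_t: "r t = 0" using r_nonneg[of t] t by simp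
  obtain s where s: "s \<in> {0..t}" "\<And>x. x \<in> {0..t} \<Longrightarrow> r x \<le> r s"
    using continuous_attains_sup[of "{0..t}" r] r_continuous[of 0 t] t by auto
  have "r s > 0"
  proof (rule ccontr)
    assume "\<not> r s > 0"
    then have "{0..t} \<subseteq> {x \<in> {0..T}. r x = 0}"
      using s(2) r_nonneg t by force
    then have "negligible {0..t}"
      by (rule negligible_subset[OF finite_potential_negligible[OF radial_pathD(2)[OF radial]]])
    then show False
      using t(1) negligible_interval(1)[of 0 t] by simp
  qed
  then have st: "0 \<le> s" "s < t"
    using s(1) r_t by (auto simp: order_less_le)
  obtain u where u: "u \<in> {t..T}" "\<And>x. x \<in> {t..u} \<Longrightarrow> r x \<le> r s" "u < T \<Longrightarrow> r u = r s"
    using first_hitting_time[of t T r "r s"] r_continuous[of t T] r_t \<open>r s > 0\<close> t by auto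
  have path: "radial_path s u r v"
    using radial_path_subinterval[OF radial] st u(1) by auto
  have "radial_action s u (\<lambda>x. r s) (\<lambda>x. 0) < radial_action s u r v"
  proof (rule radial_action_const_less[OF path \<open>r s > 0\<close>])
    show "r x \<le> r s" if "x \<in> {s..u}" for x
      using s(2)[of x] u(2)[of x] that st by (cases "x \<le> t") auto
    show "t \<in> {s..u}" "r t < r s" "s < u"
      using st u(1) r_t \<open>r s > 0\<close> by auto
  qed
  moreover have "radial_action s u r v \<le> radial_action s u (\<lambda>x. r s) (\<lambda>x. 0)"
    using st u \<open>r s > 0\<close> by (intro minimal_on_subinterval radial_path_const) auto
  ultimately show False by simp
qed

end

section \<open>The Euler--Lagrange equation\<close>

lemma zero_if_quadratic_nonneg:
  fixes x C k :: real
  assumes k: "k > 0" and C: "C \<ge> 0" and le: "\<And>e. \<bar>e\<bar> \<le> k \<Longrightarrow> 0 \<le> e * x + e\<^sup>2 * C"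
  shows "x = 0"
proof (rule ccontr)
  assume "x \<noteq> 0"
  define t where "t = min k (\<bar>x\<bar> / (2 * (C + 1)))"
  have t: "t > 0" "t \<le> k"
    using k C \<open>x \<noteq> 0\<close> by (auto simp: t_def)
  have "0 \<le> t * (t * C + x)" "0 \<le> t * (t * C - x)"
    using le[of t] le[of "- t"] t by (auto simp: power2_eq_square algebra_simps simp del: zero_le_mult_iff)
  then have "\<bar>x\<bar> \<le> t * C"
    using t by (simp add: zero_le_mult_iff abs_le_iff)
  also have "\<dots> \<le> \<bar>x\<bar> / (2 * (C + 1)) * C"
    using C by (intro mult_right_mono) (auto simp: t_def)
  also have "\<dots> < \<bar>x\<bar>"
    using C \<open>x \<noteq> 0\<close> by (simp add: field_simps add_nonneg_pos)
  finally show False by simp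
qed

lemma inverse_add_le:
  fixes x h \<rho> :: real
  assumes \<rho>: "0 < \<rho>" "\<rho> \<le> x" and h: "\<bar>h\<bar> \<le> \<rho> / 2"
  shows "1 / (x + h) \<le> 1 / x - h / x\<^sup>2 + 2 * h\<^sup>2 / \<rho> ^ 3"
proof -
  have pos: "x > 0" "\<rho> / 2 \<le> x + h" "x + h > 0"
    using assms by (auto simp: abs_le_iff)
  have "1 / (x + h) = 1 / x - h / x\<^sup>2 + h\<^sup>2 / (x\<^sup>2 * (x + h))"
    using pos by (simp add: divide_simps power2_eq_square) (simp add: algebra_simps)
  also have "h\<^sup>2 / (x\<^sup>2 * (x + h)) \<le> h\<^sup>2 / (\<rho>\<^sup>2 * (\<rho> / 2))"
    using pos \<rho> by (intro divide_left_mono mult_mono power_mono) auto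
  also have "h\<^sup>2 / (\<rho>\<^sup>2 * (\<rho> / 2)) = 2 * h\<^sup>2 / \<rho> ^ 3"
    by (simp add: power2_eq_square power3_eq_cube mult.commute)
  finally show ?thesis
    by simp
qed

context radial_minimizer
begin

definition force :: "real \<Rightarrow> real" where
  "force t = 1 / (r t)\<^sup>2 + 1"

definition momentum :: "real \<Rightarrow> real" where
  "momentum t = integral {t..T} force"

lemma force_continuous: "continuous_on {a..T} force" if "0 < a"
proof -
  have "r t \<noteq> 0" if "t \<in> {a..T}" for t
    using r_pos[of t] that \<open>0 < a\<close> by auto
  then show ?thesis
    unfolding force_def[abs_def] using that by (intro continuous_intros r_continuous) auto
qed

lemma r_bounded_below:
  assumes "0 < a" "a \<le> T"
  obtains \<rho> where "\<rho> > 0" "\<And>t. t \<in> {a..T} \<Longrightarrow> \<rho> \<le> r t"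
proof -
  obtain x where "x \<in> {a..T}" "\<And>t. t \<in> {a..T} \<Longrightarrow> r x \<le> r t"
    using continuous_attains_inf[of "{a..T}" r] r_continuous[of a T] assms by auto
  then show ?thesis
    using r_pos[of x] assms by (intro that[of "r x"]) auto
qed

lemma radial_action_variation_le:
  assumes a: "0 < a" "a \<le> T" and \<phi>: "L2_deriv a T \<phi> w"
    and \<rho>: "\<rho> > 0" "\<And>t. t \<in> {a..T} \<Longrightarrow> \<rho> \<le> r t"
    and e: "\<And>t. t \<in> {a..T} \<Longrightarrow> \<bar>e * \<phi> t\<bar> \<le> \<rho> / 2"
  shows "radial_action a T (\<lambda>t. r t + e * \<phi> t) (\<lambda>t. v t + e * w t) \<le> radial_action a T r v
    + e * (integral {a..T} (\<lambda>t. v t * w t) - integral {a..T} (\<lambda>t. \<phi> t * force t))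
    + e\<^sup>2 * (integral {a..T} (\<lambda>t. (w t)\<^sup>2 / 2) + integral {a..T} (\<lambda>t. 2 * (\<phi> t)\<^sup>2 / \<rho> ^ 3))"
proof -
  have path: "radial_path a T r v"
    using radial_path_subinterval[OF radial] a by auto
  note v = radial_pathD(1)[OF path]
  have cont: "continuous_on {a..T} r" "continuous_on {a..T} \<phi>"
    using L2_deriv_continuous[OF v] L2_deriv_continuous[OF \<phi>] by auto
  have nonzero: "r t + e * \<phi> t \<noteq> 0" if "t \<in> {a..T}" for t
    using \<rho>(1) \<rho>(2)[OF that] e[OF that] by (auto simp: abs_le_iff)
  have bound: "((\<lambda>t. 1 / r t - e * (\<phi> t * force t) + e\<^sup>2 * (2 * (\<phi> t)\<^sup>2 / \<rho> ^ 3)) has_integral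
      integral {a..T} (\<lambda>t. 1 / r t) - e * integral {a..T} (\<lambda>t. \<phi> t * force t)
      + e\<^sup>2 * integral {a..T} (\<lambda>t. 2 * (\<phi> t)\<^sup>2 / \<rho> ^ 3)) {a..T}"
    using a(1) \<rho>(1)
    by (intro has_integral_add has_integral_diff has_integral_mult_right integrable_integral
        radial_path_integrable(2)[OF path] integrable_continuous_real continuous_intros cont
        force_continuous) auto
  have "(\<lambda>t. 1 / (r t + e * \<phi> t) - e * \<phi> t) integrable_on {a..T}"
    using nonzero by (intro integrable_continuous_real continuous_intros cont) auto
  moreover have "1 / (r t + e * \<phi> t) - e * \<phi> t
      \<le> 1 / r t - e * (\<phi> t * force t) + e\<^sup>2 * (2 * (\<phi> t)\<^sup>2 / \<rho> ^ 3)" if "t \<in> {a..T}" for t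
    using inverse_add_le[OF \<rho>(1) \<rho>(2)[OF that] e[OF that]]
    by (simp add: force_def power_mult_distrib algebra_simps)
  ultimately have "integral {a..T} (\<lambda>t. 1 / (r t + e * \<phi> t) - e * \<phi> t) \<le> integral {a..T} (\<lambda>t. 1 / r t)
      - e * integral {a..T} (\<lambda>t. \<phi> t * force t) + e\<^sup>2 * integral {a..T} (\<lambda>t. 2 * (\<phi> t)\<^sup>2 / \<rho> ^ 3)"
    by (intro has_integral_le[OF integrable_integral bound])
  moreover have "integral {a..T} (\<lambda>t. 1 / (r t + e * \<phi> t) - e * \<phi> t)
      = integral {a..T} (\<lambda>t. 1 / (r t + e * \<phi> t)) - integral {a..T} (\<lambda>t. e * \<phi> t)"
    using nonzero by (intro integral_diff integrable_continuous_real continuous_intros cont) auto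
  moreover have "integral {a..T} (\<lambda>t. r t + e * \<phi> t) = integral {a..T} r + integral {a..T} (\<lambda>t. e * \<phi> t)"
    by (intro integral_add integrable_continuous_real continuous_intros cont)
  ultimately show ?thesis
    unfolding radial_action_def integral_power2_add_scaled[OF v \<phi>] by (simp add: algebra_simps)
qed

lemma first_variation:
  assumes a: "0 < a" "a \<le> T" and \<phi>: "L2_deriv a T \<phi> w" "\<phi> a = 0"
  shows "integral {a..T} (\<lambda>t. v t * w t) = integral {a..T} (\<lambda>t. \<phi> t * force t)"
proof -
  define X where "X = integral {a..T} (\<lambda>t. v t * w t) - integral {a..T} (\<lambda>t. \<phi> t * force t)"
  obtain \<rho> where \<rho>: "\<rho> > 0" "\<And>t. t \<in> {a..T} \<Longrightarrow> \<rho> \<le> r t"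
    using r_bounded_below[OF a] by blast
  define C where "C = integral {a..T} (\<lambda>t. (w t)\<^sup>2 / 2) + integral {a..T} (\<lambda>t. 2 * (\<phi> t)\<^sup>2 / \<rho> ^ 3)"
  have \<phi>_cont: "continuous_on {a..T} \<phi>"
    by (rule L2_deriv_continuous[OF \<phi>(1)])
  then have "bounded (\<phi> ` {a..T})"
    by (intro compact_imp_bounded compact_continuous_image) auto
  then obtain B where B: "B > 0" "\<And>t. t \<in> {a..T} \<Longrightarrow> \<bar>\<phi> t\<bar> \<le> B"
    by (auto simp: bounded_pos)
  have "X = 0"
  proof (rule zero_if_quadratic_nonneg[of "\<rho> / (2 * B)" C])
    show "\<rho> / (2 * B) > 0" using \<rho>(1) B(1) by simp
    have "0 \<le> integral {a..T} (\<lambda>t. (w t)\<^sup>2 / 2)"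
      using integrable_on_divide[OF L2_deriv_integrable(3)[OF \<phi>(1)], of a T 2]
      by (intro integral_nonneg) simp_all
    moreover have "0 \<le> integral {a..T} (\<lambda>t. 2 * (\<phi> t)\<^sup>2 / \<rho> ^ 3)"
      using \<rho>(1) by (intro integral_nonneg integrable_continuous_real continuous_intros \<phi>_cont) auto
    ultimately show "C \<ge> 0" by (simp add: C_def)
    fix e assume e: "\<bar>e\<bar> \<le> \<rho> / (2 * B)"
    have small: "\<bar>e * \<phi> t\<bar> \<le> \<rho> / 2" if "t \<in> {a..T}" for t
      using mult_mono[OF e B(2)[OF that]] B(1) \<rho>(1) by (simp add: abs_mult)
    have "r t + e * \<phi> t > 0" if "t \<in> {a..T}" for t
      using small[OF that] \<rho>(1) \<rho>(2)[OF that] by (auto simp: abs_le_iff)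
    then have "radial_path a T (\<lambda>t. r t + e * \<phi> t) (\<lambda>t. v t + e * w t)"
      using a by (intro radial_path_add_scaled[OF L2_deriv_subinterval[OF radial_pathD(1)[OF radial]] \<phi>(1)])
        auto
    then have "radial_action a T r v \<le> radial_action a T (\<lambda>t. r t + e * \<phi> t) (\<lambda>t. v t + e * w t)"
      using a \<phi>(2) by (intro minimal_on_subinterval) auto
    also have "\<dots> \<le> radial_action a T r v + e * X + e\<^sup>2 * C"
      unfolding X_def C_def using a \<phi>(1) \<rho> small by (rule radial_action_variation_le)
    finally show "0 \<le> e * X + e\<^sup>2 * C" by simp
  qed
  then show ?thesis by (simp add: X_def)
qed

lemma momentum_increment:
  assumes "0 < a" "a \<le> b" "b \<le> T"
  shows "momentum b - momentum a = integral {a..b} (\<lambda>t. - force t)"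
  using Henstock_Kurzweil_Integration.integral_combine[of a b T force] assms
    integrable_continuous_real[OF force_continuous[of a]] by (simp add: momentum_def)

lemma momentum_deriv: "x \<in> {0<..T} \<Longrightarrow> (momentum has_real_derivative - force x) (at x within {0<..T})"
  by (rule has_real_derivative_if_integral[where h = "\<lambda>t. - force t", OF _ momentum_increment])
    (auto intro!: continuous_intros force_continuous)

lemma momentum_continuous: "0 < a \<Longrightarrow> continuous_on {a..T} momentum"
  by (rule continuous_on_subset[OF DERIV_continuous_on[OF momentum_deriv]]) auto

lemma integral_momentum:
  assumes ab: "0 < a" "a \<le> b" "b \<le> T"
  shows "integral {a..b} momentum = integral {a..b} (\<lambda>t. (t - a) * force t) + (b - a) * momentum b"
proof -
  have cont: "continuous_on {a..b} momentum" "continuous_on {a..b} force"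
    using ab(3) by (auto intro: continuous_on_subset[OF momentum_continuous[OF ab(1)]]
        continuous_on_subset[OF force_continuous[OF ab(1)]])
  have "((\<lambda>t. momentum t - (t - a) * force t) has_integral
      (b - a) * momentum b - (a - a) * momentum a) {a..b}"
  proof (rule fundamental_theorem_of_calculus[OF ab(2)])
    fix x assume x: "x \<in> {a..b}"
    have "(momentum has_real_derivative - force x) (at x within {a..b})"
      using x ab by (intro DERIV_subset[OF momentum_deriv]) auto
    then have "((\<lambda>t. (t - a) * momentum t) has_real_derivative momentum x - (x - a) * force x)
        (at x within {a..b})"
      by (auto intro!: derivative_eq_intros)
    then show "((\<lambda>t. (t - a) * momentum t) has_vector_derivative momentum x - (x - a) * force x)
        (at x within {a..b})"
      by (simp add: has_real_derivative_iff_has_vector_derivative)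
  qed
  moreover have "integral {a..b} (\<lambda>t. momentum t - (t - a) * force t)
      = integral {a..b} momentum - integral {a..b} (\<lambda>t. (t - a) * force t)"
    by (intro integral_diff integrable_continuous_real continuous_intros cont)
  ultimately show ?thesis
    by (simp add: integral_unique)
qed

text \<open>The first variation along a ramp that rises on \<open>[a, b]\<close> and is constant afterwards; letting its
  end at time \<open>T\<close> move freely makes \<open>momentum T = 0\<close> the natural boundary condition.\<close>

lemma r_increment:
  assumes ab: "0 < a" "a \<le> b" "b \<le> T"
  shows "r b - r a = integral {a..b} momentum"
proof -
  define \<phi> where "\<phi> t = (if t \<le> b then t - a else b - a)" for t
  define w where "w t = (if t \<le> b then 1 else 0 :: real)" for t
  have "((\<lambda>u. 1) has_integral t - a) {a..t}" if "t \<in> {a..b}" for t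
    using has_integral_const_real[of "1::real" a t] that by simp
  then have "L2_deriv a b (\<lambda>t. t - a) (\<lambda>t. 1)"
    unfolding L2_deriv_def by (auto intro!: borel_integrable_atLeastAtMost' continuous_intros)
  then have \<phi>_deriv: "L2_deriv a T \<phi> w"
    unfolding \<phi>_def[abs_def] w_def[abs_def] using ab by (intro L2_deriv_glue L2_deriv_const) auto
  have "(v has_integral r b - r a) {a..b}"
    using ab by (intro L2_deriv_has_integral[OF radial_pathD(1)[OF radial]]) auto
  from has_integral_If_le[OF this has_integral_0[of "{b..T}"] ab(2,3)]
  have "r b - r a = integral {a..T} (\<lambda>t. v t * w t)"
    by (simp add: w_def if_distrib[of "(*) _"] integral_unique cong: if_cong)
  also have "\<dots> = integral {a..T} (\<lambda>t. \<phi> t * force t)"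
    using ab by (intro first_variation \<phi>_deriv) (auto simp: \<phi>_def)
  also have "\<dots> = integral {a..b} (\<lambda>t. (t - a) * force t) + integral {b..T} (\<lambda>t. (b - a) * force t)"
    unfolding \<phi>_def if_distrib[of "\<lambda>x. x * _"] using ab
    by (intro integral_If_le integrable_continuous_real continuous_intros force_continuous
        continuous_on_subset[OF force_continuous[of a]]) auto
  also have "integral {b..T} (\<lambda>t. (b - a) * force t) = (b - a) * momentum b"
    by (simp add: momentum_def)
  also have "integral {a..b} (\<lambda>t. (t - a) * force t) + (b - a) * momentum b = integral {a..b} momentum"
    by (rule integral_momentum[OF ab, symmetric])
  finally show ?thesis .
qed

lemma r_deriv: "x \<in> {0<..T} \<Longrightarrow> (r has_real_derivative momentum x) (at x within {0<..T})"
  by (rule has_real_derivative_if_integral) (auto intro: momentum_continuous r_increment)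

lemma momentum_end: "momentum T = 0"
  by (simp add: momentum_def)

end

section \<open>Periodic extension\<close>

definition triangle_wave :: "real \<Rightarrow> real \<Rightarrow> real" where
  "triangle_wave T t = T / pi * arccos (cos (pi * t / T))"

lemma triangle_wave_mem: "triangle_wave T t \<in> {0..T}" if "T > 0"
proof -
  have "0 \<le> arccos (cos (pi * t / T))" "arccos (cos (pi * t / T)) \<le> pi"
    by (auto intro!: arccos_lbound arccos_ubound)
  then show ?thesis
    using that pi_gt_zero by (simp add: triangle_wave_def field_simps)
qed

lemma triangle_wave_ident: "triangle_wave T t = t" if "t \<in> {0..T}" "T > 0"
proof -
  have "arccos (cos (pi * t / T)) = pi * t / T"
    using that by (intro arccos_cos) (auto simp: field_simps)
  then show ?thesis
    using that(2) by (simp add: triangle_wave_def)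
qed

lemma triangle_wave_minus: "triangle_wave T (- t) = triangle_wave T t"
  by (simp add: triangle_wave_def)

lemma triangle_wave_periodic: "triangle_wave T (t + 2 * T * of_int k) = triangle_wave T t"
proof (cases "T = 0")
  case False
  then have "pi * (t + 2 * T * of_int k) / T = pi * t / T + of_int k * (2 * pi)"
    by (simp add: field_simps)
  moreover have "cos (pi * t / T + of_int k * (2 * pi)) = cos (pi * t / T)"
    using cos.plus_of_int[of "pi * t / T" k] by simp
  ultimately show ?thesis
    unfolding triangle_wave_def by (simp only:)
qed (simp add: triangle_wave_def)

lemma continuous_on_triangle_wave: "continuous_on A (triangle_wave T)"
  unfolding triangle_wave_def[abs_def] by (cases "T = 0") (auto intro!: continuous_intros)

lemma triangle_wave_eq_0_iff: "triangle_wave T t = 0 \<longleftrightarrow> (\<exists>k::int. t = 2 * T * of_int k)" if "T > 0"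
proof -
  have "triangle_wave T t = 0 \<longleftrightarrow> arccos (cos (pi * t / T)) = arccos 1"
    using that by (simp add: triangle_wave_def)
  also have "\<dots> \<longleftrightarrow> cos (pi * t / T) = 1"
    by (rule arccos_eq_iff) simp
  also have "\<dots> \<longleftrightarrow> (\<exists>k::int. pi * t / T = of_int k * 2 * pi)"
    by (rule cos_one_2pi_int)
  also have "\<dots> \<longleftrightarrow> (\<exists>k::int. t = 2 * T * of_int k)"
    using that by (intro arg_cong[where f=Ex] ext) (auto simp: field_simps)
  finally show ?thesis .
qed

lemma triangle_wave_falling: "triangle_wave T t = 2 * T - t" if "t \<in> {T..2 * T}" "T > 0"
proof -
  have "triangle_wave T t = triangle_wave T (2 * T - t)"
    using triangle_wave_periodic[of T "- t" 1] by (simp add: triangle_wave_minus)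
  then show ?thesis
    using that by (simp add: triangle_wave_ident)
qed

context radial_minimizer
begin

definition distance :: "real \<Rightarrow> real" where
  "distance t = r (triangle_wave T t)"

definition half_speed :: "real \<Rightarrow> real" where
  "half_speed t = (if t \<le> T then momentum t else - momentum (2 * T - t))"

definition speed :: "real \<Rightarrow> real" where
  "speed t = half_speed (t - 2 * T * of_int \<lfloor>t / (2 * T)\<rfloor>)"

lemma distance_periodic: "distance (t + 2 * T * of_int k) = distance t"
  by (simp add: distance_def triangle_wave_periodic)

lemma speed_periodic: "speed (t + 2 * T * of_int k) = speed t"
proof -
  have "(t + 2 * T * of_int k) / (2 * T) = t / (2 * T) + of_int k"
    using T_pos by (simp add: field_simps)
  then show ?thesis
    by (simp add: speed_def algebra_simps)
qed

lemma distance_on_period: "distance t = (if t \<le> T then r t else r (2 * T - t))" if "t \<in> {0..2 * T}"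
  using that T_pos by (simp add: distance_def triangle_wave_ident triangle_wave_falling)

lemma speed_on_period: "speed t = half_speed t" if "t \<in> {0..<2 * T}"
proof -
  have "\<lfloor>t / (2 * T)\<rfloor> = 0"
    using that T_pos by (intro floor_unique) auto
  then show ?thesis by (simp add: speed_def)
qed

lemma distance_eq_0_iff: "distance t = 0 \<longleftrightarrow> (\<exists>k::int. t = 2 * T * of_int k)"
proof -
  have "r s = 0 \<longleftrightarrow> s = 0" if "s \<in> {0..T}" for s
    using r_pos[of s] r_start that by (cases "s = 0") auto
  then show ?thesis
    using triangle_wave_mem[OF T_pos] triangle_wave_eq_0_iff[OF T_pos] by (simp add: distance_def)
qed

lemma distance_deriv_on_period: "(distance has_real_derivative speed t) (at t)" if "t \<in> {0<..<2 * T}"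
proof -
  have "((\<lambda>t. if t \<le> T then r t else r (2 * T - t)) has_real_derivative half_speed t) (at t)"
    using has_real_derivative_reflect_extension[where k = 1, OF r_deriv _ _ that]
    by (simp add: half_speed_def momentum_end cong: if_cong)
  then have "(distance has_real_derivative half_speed t) (at t)"
    by (rule has_field_derivative_transform_within_open[OF _ open_greaterThanLessThan that])
      (simp add: distance_on_period)
  then show ?thesis
    using that by (simp add: speed_on_period)
qed

lemma speed_deriv_on_period: "(speed has_real_derivative - (1 / (distance t)\<^sup>2 + 1)) (at t)"
  if "t \<in> {0<..<2 * T}"
proof -
  have "(half_speed has_real_derivative (if t \<le> T then - force t else - force (2 * T - t))) (at t)"
    using has_real_derivative_reflect_extension[where k = "- 1", OF momentum_deriv _ _ that]
    by (simp add: half_speed_def[abs_def] momentum_end cong: if_cong)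
  moreover have "(if t \<le> T then - force t else - force (2 * T - t)) = - (1 / (distance t)\<^sup>2 + 1)"
    using that by (simp add: force_def distance_on_period)
  ultimately have "(half_speed has_real_derivative - (1 / (distance t)\<^sup>2 + 1)) (at t)"
    by simp
  then show ?thesis
    by (rule has_field_derivative_transform_within_open[OF _ open_greaterThanLessThan that])
      (simp add: speed_on_period)
qed

lemma distance_solves_radial_equation:
  assumes "distance t \<noteq> 0"
  shows "(distance has_real_derivative speed t) (at t)"
    and "(speed has_real_derivative - (1 / (distance t)\<^sup>2 + 1)) (at t)"
proof -
  define k where "k = \<lfloor>t / (2 * T)\<rfloor>"
  define u where "u = t - 2 * T * of_int k"
  have "of_int k \<le> t / (2 * T)" "t / (2 * T) < of_int k + 1"
    unfolding k_def by linarith+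
  then have "0 \<le> u" "u < 2 * T"
    using T_pos by (simp_all add: u_def field_simps)
  moreover have "t \<noteq> 2 * T * of_int k"
    using assms distance_eq_0_iff by blast
  then have "u \<noteq> 0" by (simp add: u_def)
  ultimately have u: "u \<in> {0<..<2 * T}" by simp
  have t: "t = u + 2 * T * of_int k" by (simp add: u_def)
  show "(distance has_real_derivative speed t) (at t)"
    unfolding t speed_periodic
    by (intro has_real_derivative_periodic distance_periodic distance_deriv_on_period u)
  show "(speed has_real_derivative - (1 / (distance t)\<^sup>2 + 1)) (at t)"
    unfolding t distance_periodic
    by (intro has_real_derivative_periodic speed_periodic speed_deriv_on_period u)
qed

definition orbit :: "real \<Rightarrow> real \<times> real" where
  "orbit t = (- distance t, 0)"

definition orbit_velocity :: "real \<Rightarrow> real \<times> real" where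
  "orbit_velocity t = (- speed t, 0)"

lemma orbit_extends: "t \<in> {0..T} \<Longrightarrow> orbit t = (- r t, 0)"
  using T_pos by (simp add: orbit_def distance_def triangle_wave_ident)

lemma continuous_on_orbit: "continuous_on UNIV orbit"
  unfolding orbit_def[abs_def] distance_def[abs_def]
  using triangle_wave_mem[OF T_pos]
  by (intro continuous_intros continuous_on_compose2[OF r_continuous[of 0 T] continuous_on_triangle_wave]) auto

lemma orbit_periodic: "orbit (t + 2 * T) = orbit t"
  using distance_periodic[of t 1] by (simp add: orbit_def)

lemma orbit_even: "orbit (- t) = orbit t"
  by (simp add: orbit_def distance_def triangle_wave_minus)

lemma orbit_eq_0_iff: "orbit t = 0 \<longleftrightarrow> (\<exists>k::int. t = 2 * T * of_int k)"
  using distance_eq_0_iff[of t] by (simp add: orbit_def zero_prod_def)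

lemma orbit_on_negative_axis: "snd (orbit t) = 0" "fst (orbit t) \<le> 0"
  using r_nonneg[OF triangle_wave_mem[OF T_pos]] by (simp_all add: orbit_def distance_def)

lemma orbit_solves_stark:
  assumes "orbit t \<noteq> 0"
  shows "(orbit has_vector_derivative orbit_velocity t) (at t)"
    and "(orbit_velocity has_vector_derivative stark_field (orbit t)) (at t)"
proof -
  have nonzero: "distance t \<noteq> 0"
    using assms by (auto simp: orbit_def zero_prod_def)
  then have pos: "distance t > 0"
    using r_nonneg[OF triangle_wave_mem[OF T_pos], of t] by (simp add: distance_def)
  have field: "stark_field (orbit t) = (- (- (1 / (distance t)\<^sup>2 + 1)), 0)"
    using pos by (simp add: stark_field_def orbit_def norm_Pair power2_eq_square power3_eq_cube)
  have negate: "((\<lambda>t. (- f t, 0::real)) has_vector_derivative (- D, 0)) (at t)"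
    if "(f has_real_derivative D) (at t)" for f D
    using that unfolding has_real_derivative_iff_has_vector_derivative
    by (intro has_vector_derivative_Pair has_vector_derivative_minus has_vector_derivative_const)
  show "(orbit has_vector_derivative orbit_velocity t) (at t)"
    unfolding orbit_def[abs_def] orbit_velocity_def
    by (rule negate[OF distance_solves_radial_equation(1)[OF nonzero]])
  show "(orbit_velocity has_vector_derivative stark_field (orbit t)) (at t)"
    unfolding field orbit_velocity_def[abs_def]
    by (rule negate[OF distance_solves_radial_equation(2)[OF nonzero]])
qed

end

theorem theorem1p5:
  fixes T :: real and q :: "real \<Rightarrow> real \<times> real"
  assumes "T > 0"
    and "global_minimizer T q"
  shows "\<exists>Q Q' :: real \<Rightarrow> real \<times> real.
           (\<forall>t\<in>{0..T}. Q t = q t) \<and>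
           continuous_on UNIV Q \<and>
           (\<forall>t. Q (t + 2 * T) = Q t) \<and>
           (\<forall>t. Q (- t) = Q t) \<and>
           (\<forall>t. Q t = 0 \<longleftrightarrow> (\<exists>k::int. t = 2 * T * of_int k)) \<and>
           (\<forall>t. snd (Q t) = 0 \<and> fst (Q t) \<le> 0) \<and>
           (\<forall>t. Q t \<noteq> 0 \<longrightarrow>
                (Q has_vector_derivative Q' t) (at t) \<and>
                (Q' has_vector_derivative stark_field (Q t)) (at t))"
proof -
  note axis = minimizer_on_negative_axis[OF assms]
  obtain v where v: "H1_deriv T q v" and "fst (q 0) \<ge> 0"
    using assms(2) by (auto simp: global_minimizer_def Omega_def H1_def)
  note radial = radial_path_if_on_negative_axis[OF v axis]
  interpret radial_minimizer T "\<lambda>t. - fst (q t)" "\<lambda>t. - fst (v t)"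
  proof
    show "- fst (q 0) = 0"
      using axis(2)[of 0] \<open>fst (q 0) \<ge> 0\<close> \<open>T > 0\<close> by simp
    show "radial_lower_bound T (radial_action 0 T (\<lambda>t. - fst (q t)) (\<lambda>t. - fst (v t)))"
      using assms radial(2) by (intro radial_lower_bound_minimizer) auto
  qed (use \<open>T > 0\<close> radial(1) in auto)
  have extends: "orbit t = q t" if "t \<in> {0..T}" for t
    using orbit_extends[OF that] axis(2)[OF that] by (simp add: prod_eq_iff)
  show ?thesis
    by (intro exI[of _ orbit] exI[of _ orbit_velocity] conjI ballI allI impI)
      (rule extends continuous_on_orbit orbit_periodic orbit_even orbit_eq_0_iff
        orbit_on_negative_axis orbit_solves_stark; assumption?)+
qed

end
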